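(* Let $\Omega$ be a countably infinite set and let $G\leq\mathrm{Sym}(\Omega)$ be a closed permutation group which acts without fixed point on $\Omega$. If $G$ is dissociated, then the following properties are equivalent. (i) $G$ has the Howe-Moore property. (ii) Every proper open subgroup of $G$ is coarsely bounded. (iii) For every non-empty finite subset $A\subseteq\Omega$, the setwise stabilizer $G_{\{A\}}$ is coarsely bounded. (iv) For every non-empty finite subset $A\subseteq\Omega$, the pointwise stabilizer $G_A$ is coarsely bounded. (v) For every $a\in\Omega$, the point stabilizer $G_a$ is coarsely bounded.
   Context: $\mathrm{Sym}(\Omega)$ is the group of all permutations of the countably infinite set $\Omega$ with the topology of pointwise convergence; a closed permutation group on $\Omega$ is a closed subgroup $G\leq\mathrm{Sym}(\Omega)$. For $A\subseteq\Omega$, $G_A=\{g\in G: g(a)=a\text{ for all }a\in A\}$ and $G_{\{A\}}=\{g\in G: g(A)=A\}$; $G_a=G_{\{a\}}$ is the stabilizer of the point $a$. A unitary representation of a topological group $G$ on a Hilbert space $\mathcal{H}$ is a homomorphism $\pi:G\to\mathcal{U}(\mathcal{H})$ such that $g\mapsto\pi(g)\xi$ is continuous for every $\xi\in\mathcal{H}$. For a closed permutation group $G$ and finite $A\subseteq\Omega$, $p_A$ is the orthogonal projection onto $\mathcal{H}_A=\{\xi\in\mathcal{H}:\pi(g)\xi=\xi\text{ for all }g\in G_A\}$. The representation is dissociated if $p_Ap_B=p_{A\cap B}$ for all finite $A,B\subseteq\Omega$. The group $G$ is dissociated if all of its unitary representations are dissociated. An écart on a topological group $G$ is a map $\delta:G^2\to\mathbb{R}_+$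 with $\delta(x,x)=0$ and $\delta(x,z)\leq\delta(x,y)+\delta(y,z)$ for all $x,y,z\in G$; it is left-invariant if $\delta(xy,xz)=\delta(y,z)$ for all $x,y,z$. A subset $B\subseteq G$ is coarsely bounded if its $\delta$-diameter is finite for every continuous left-invariant écart $\delta$ on $G$. A function $f:G\to\mathbb{C}$ vanishes at infinity if for every $\varepsilon>0$ the set $\{x\in G:|f(x)|\geq\varepsilon\}$ is coarsely bounded; $C_0(G)$ is the set of all such continuous functions. A topological group $G$ has the Howe-Moore property if for every unitary representation $\pi:G\to\mathcal{U}(\mathcal{H})$ with no non-zero invariant vector and all $\xi,\eta\in\mathcal{H}$, the map $g\mapsto\langle\pi(g)\xi\mid\eta\rangle$ belongs to $C_0(G)$. *)

theory Defs
  imports "HOL-Analysis.Analysis" "HOL-Algebra.Bij" "HOL-Algebra.Module"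
begin

section \<open>Closed permutation groups\<close>

text \<open>
  The group \<open>Sym(\<Omega>)\<close> is \<^const>\<open>BijGroup\<close> of \<open>\<Omega>\<close>; its elements are extensional functions, so they
  are points of the power \<open>\<Omega>\<^sup>\<Omega>\<close> as formed by \<^const>\<open>product_topology\<close>.
\<close>

definition Sym_topology :: "'a set \<Rightarrow> ('a \<Rightarrow> 'a) topology" where
  "Sym_topology \<Omega> = subtopology (product_topology (\<lambda>_. discrete_topology \<Omega>) \<Omega>) (Bij \<Omega>)"

definition closed_permutation_group :: "'a set \<Rightarrow> ('a \<Rightarrow> 'a) set \<Rightarrow> bool" where
  "closed_permutation_group \<Omega> G \<longleftrightarrow> subgroup G (BijGroup \<Omega>) \<and> closedin (Sym_topology \<Omega>) G"

definition perm_group :: "'a set \<Rightarrow> ('a \<Rightarrow> 'a) set \<Rightarrow> ('a \<Rightarrow> 'a) monoid" where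
  "perm_group \<Omega> G = BijGroup \<Omega> \<lparr>carrier := G\<rparr>"

definition perm_topology :: "'a set \<Rightarrow> ('a \<Rightarrow> 'a) set \<Rightarrow> ('a \<Rightarrow> 'a) topology" where
  "perm_topology \<Omega> G = subtopology (Sym_topology \<Omega>) G"

definition pointwise_stabilizer :: "('a \<Rightarrow> 'a) set \<Rightarrow> 'a set \<Rightarrow> ('a \<Rightarrow> 'a) set" where
  "pointwise_stabilizer G A = {g \<in> G. \<forall>a\<in>A. g a = a}"

definition setwise_stabilizer :: "('a \<Rightarrow> 'a) set \<Rightarrow> 'a set \<Rightarrow> ('a \<Rightarrow> 'a) set" where
  "setwise_stabilizer G A = {g \<in> G. g ` A = A}"


section \<open>Coarsely bounded sets and functions vanishing at infinity\<close>

text \<open>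
  A topological group is given by a group \<open>G\<close> together with a topology \<open>T\<close> whose underlying set is
  the carrier of \<open>G\<close>.
\<close>

definition ecart :: "('g, 'm) monoid_scheme \<Rightarrow> ('g \<Rightarrow> 'g \<Rightarrow> real) \<Rightarrow> bool" where
  "ecart G \<delta> \<longleftrightarrow>
     (\<forall>x\<in>carrier G. \<forall>y\<in>carrier G. 0 \<le> \<delta> x y) \<and>
     (\<forall>x\<in>carrier G. \<delta> x x = 0) \<and>
     (\<forall>x\<in>carrier G. \<forall>y\<in>carrier G. \<forall>z\<in>carrier G. \<delta> x z \<le> \<delta> x y + \<delta> y z)"

definition left_invariant :: "('g, 'm) monoid_scheme \<Rightarrow> ('g \<Rightarrow> 'g \<Rightarrow> real) \<Rightarrow> bool" where
  "left_invariant G \<delta> \<longleftrightarrow>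
     (\<forall>x\<in>carrier G. \<forall>y\<in>carrier G. \<forall>z\<in>carrier G. \<delta> (x \<otimes>\<^bsub>G\<^esub> y) (x \<otimes>\<^bsub>G\<^esub> z) = \<delta> y z)"

definition coarsely_bounded :: "('g, 'm) monoid_scheme \<Rightarrow> 'g topology \<Rightarrow> 'g set \<Rightarrow> bool" where
  "coarsely_bounded G T B \<longleftrightarrow> B \<subseteq> carrier G \<and>
     (\<forall>\<delta>. ecart G \<delta> \<and> left_invariant G \<delta> \<and>
          continuous_map (prod_topology T T) euclideanreal (\<lambda>(x, y). \<delta> x y) \<longrightarrow>
          (\<exists>C. \<forall>x\<in>B. \<forall>y\<in>B. \<delta> x y \<le> C))"

definition vanishes_at_infinity ::
    "('g, 'm) monoid_scheme \<Rightarrow> 'g topology \<Rightarrow> ('g \<Rightarrow> complex) \<Rightarrow> bool" where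
  "vanishes_at_infinity G T f \<longleftrightarrow>
     (\<forall>\<epsilon>>0. coarsely_bounded G T {x \<in> carrier G. cmod (f x) \<ge> \<epsilon>})"

definition C0 :: "('g, 'm) monoid_scheme \<Rightarrow> 'g topology \<Rightarrow> ('g \<Rightarrow> complex) set" where
  "C0 G T = {f. continuous_map T euclidean f \<and> vanishes_at_infinity G T f}"


section \<open>Complex Hilbert spaces\<close>

text \<open>
  Hilbert spaces are structures with an explicit carrier, because the notions below quantify over
  all Hilbert spaces. The ring multiplication and unit that \<open>module\<close> inherits from \<open>ring\<close> are unused.
\<close>

definition complex_ring :: "complex ring" where
  "complex_ring = \<lparr>carrier = UNIV, mult = (*), one = 1, zero = 0, add = (+)\<rparr>"

record 'h inner_product_space = "(complex, 'h) module" +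
  iprod :: "'h \<Rightarrow> 'h \<Rightarrow> complex"

text \<open>
  The distance is set to 0 off the carrier, since \<^locale>\<open>Metric_space\<close> asks for non-negativity and
  symmetry on the whole type.
\<close>

definition hdist :: "('h, 'm) inner_product_space_scheme \<Rightarrow> 'h \<Rightarrow> 'h \<Rightarrow> real" where
  "hdist H x y = (if x \<in> carrier H \<and> y \<in> carrier H
     then sqrt (Re (iprod H (x \<ominus>\<^bsub>H\<^esub> y) (x \<ominus>\<^bsub>H\<^esub> y))) else 0)"

definition htopology :: "('h, 'm) inner_product_space_scheme \<Rightarrow> 'h topology" where
  "htopology H = Metric_space.mtopology (carrier H) (hdist H)"

locale hilbert_space = Module.module complex_ring H
  for H :: "('h, 'm) inner_product_space_scheme" (structure) +
  assumes iprod_add: "\<lbrakk>x \<in> carrier H; y \<in> carrier H; z \<in> carrier H\<rbrakk> \<Longrightarrow>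
      iprod H (x \<oplus> y) z = iprod H x z + iprod H y z"
    and iprod_smult: "\<lbrakk>x \<in> carrier H; y \<in> carrier H\<rbrakk> \<Longrightarrow> iprod H (c \<odot> x) y = c * iprod H x y"
    and iprod_commute: "\<lbrakk>x \<in> carrier H; y \<in> carrier H\<rbrakk> \<Longrightarrow> iprod H y x = cnj (iprod H x y)"
    and iprod_nonneg: "x \<in> carrier H \<Longrightarrow> 0 \<le> Re (iprod H x x)"
    and iprod_eq_zero: "\<lbrakk>x \<in> carrier H; iprod H x x = 0\<rbrakk> \<Longrightarrow> x = \<zero>"
    and complete: "Metric_space.mcomplete (carrier H) (hdist H)"

definition orthogonal_projection ::
    "('h, 'm) inner_product_space_scheme \<Rightarrow> 'h set \<Rightarrow> 'h \<Rightarrow> 'h" where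
  "orthogonal_projection H S x =
     (THE y. y \<in> S \<and> (\<forall>z\<in>S. iprod H (x \<ominus>\<^bsub>H\<^esub> y) z = 0))"

definition unitary_group :: "('h, 'm) inner_product_space_scheme \<Rightarrow> ('h \<Rightarrow> 'h) monoid" where
  "unitary_group H = BijGroup (carrier H) \<lparr>carrier := {U \<in> Bij (carrier H).
     (\<forall>x\<in>carrier H. \<forall>y\<in>carrier H. U (x \<oplus>\<^bsub>H\<^esub> y) = U x \<oplus>\<^bsub>H\<^esub> U y) \<and>
     (\<forall>c. \<forall>x\<in>carrier H. U (c \<odot>\<^bsub>H\<^esub> x) = c \<odot>\<^bsub>H\<^esub> U x) \<and>
     (\<forall>x\<in>carrier H. \<forall>y\<in>carrier H. iprod H (U x) (U y) = iprod H x y)}\<rparr>"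


section \<open>Unitary representations\<close>

definition unitary_representation ::
    "('g, 'm) monoid_scheme \<Rightarrow> 'g topology \<Rightarrow> 'h inner_product_space \<Rightarrow> ('g \<Rightarrow> 'h \<Rightarrow> 'h) \<Rightarrow> bool" where
  "unitary_representation G T H \<pi> \<longleftrightarrow>
     hilbert_space H \<and> \<pi> \<in> hom G (unitary_group H) \<and>
     (\<forall>\<xi>\<in>carrier H. continuous_map T (htopology H) (\<lambda>g. \<pi> g \<xi>))"

definition fixed_vectors ::
    "'h inner_product_space \<Rightarrow> ('g \<Rightarrow> 'h \<Rightarrow> 'h) \<Rightarrow> 'g set \<Rightarrow> 'h set" where
  "fixed_vectors H \<pi> K = {\<xi> \<in> carrier H. \<forall>g\<in>K. \<pi> g \<xi> = \<xi>}"

text \<open>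
  HOL cannot quantify over all types inside a formula, so \<open>all unitary representations\<close> means: all
  representations on Hilbert spaces whose carrier is any subset of a given type \<open>'h\<close>, which serves
  as the universe and is passed as the argument \<open>TYPE('h)\<close>. Statements using these notions should
  be polymorphic in \<open>'h\<close>. A type \<open>'h\<close> with fewer elements than the continuum carries only the zero
  Hilbert space, as a non-zero complex vector space has at least continuum many elements.
\<close>

definition Howe_Moore :: "'h itself \<Rightarrow> ('g, 'm) monoid_scheme \<Rightarrow> 'g topology \<Rightarrow> bool" where
  "Howe_Moore (_ :: 'h itself) G T \<longleftrightarrow>
     (\<forall>(H :: 'h inner_product_space) \<pi>.
        unitary_representation G T H \<pi> \<and> fixed_vectors H \<pi> (carrier G) = {\<zero>\<^bsub>H\<^esub>} \<longrightarrow>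
        (\<forall>\<xi>\<in>carrier H. \<forall>\<eta>\<in>carrier H. (\<lambda>g. iprod H (\<pi> g \<xi>) \<eta>) \<in> C0 G T))"

definition stabilizer_projection ::
    "('a \<Rightarrow> 'a) set \<Rightarrow> 'h inner_product_space \<Rightarrow> (('a \<Rightarrow> 'a) \<Rightarrow> 'h \<Rightarrow> 'h) \<Rightarrow> 'a set \<Rightarrow> 'h \<Rightarrow> 'h" where
  "stabilizer_projection G H \<pi> A =
     orthogonal_projection H (fixed_vectors H \<pi> (pointwise_stabilizer G A))"

definition dissociated_representation ::
    "'a set \<Rightarrow> ('a \<Rightarrow> 'a) set \<Rightarrow> 'h inner_product_space \<Rightarrow> (('a \<Rightarrow> 'a) \<Rightarrow> 'h \<Rightarrow> 'h) \<Rightarrow> bool" where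
  "dissociated_representation \<Omega> G H \<pi> \<longleftrightarrow>
     (\<forall>A B. finite A \<and> A \<subseteq> \<Omega> \<and> finite B \<and> B \<subseteq> \<Omega> \<longrightarrow>
        (\<forall>\<xi>\<in>carrier H. stabilizer_projection G H \<pi> A (stabilizer_projection G H \<pi> B \<xi>) =
                       stabilizer_projection G H \<pi> (A \<inter> B) \<xi>))"

definition dissociated_group :: "'h itself \<Rightarrow> 'a set \<Rightarrow> ('a \<Rightarrow> 'a) set \<Rightarrow> bool" where
  "dissociated_group (_ :: 'h itself) \<Omega> G \<longleftrightarrow>
     (\<forall>(H :: 'h inner_product_space) \<pi>.
        unitary_representation (perm_group \<Omega> G) (perm_topology \<Omega> G) H \<pi> \<longrightarrow>
        dissociated_representation \<Omega> G H \<pi>)"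

end

theory Submission
  imports Defs "HOL-Algebra.Group_Action"
begin

text \<open>
  The five properties are shown to imply each other in a cycle, in which three implications have
  content.

  Point stabilizers being coarsely bounded gives the Howe-Moore property. Pointwise stabilizers
  \<open>G\<^sub>A\<close> of finite sets \<open>A\<close> form a neighbourhood basis of the identity, so every vector is almost
  fixed by one of them, and a convexity argument replaces it by a nearby vector that is exactly fixed
  (\<open>fixed_vectors_dense\<close>). So it suffices to treat \<open>\<xi>\<close> fixed by \<open>G\<^sub>A\<close> and \<open>\<eta>\<close> fixed by
  \<open>G\<^sub>B\<close>. Then \<open>\<pi> g \<xi>\<close> is fixed by the stabilizer of \<open>g(A)\<close>, and if \<open>g(A)\<close> and \<open>B\<close>
  are disjoint, dissociation makes the projection of \<open>\<pi> g \<xi>\<close> onto the vectors fixed by \<open>G\<^sub>B\<close>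
  invariant under all of \<open>G\<close>, hence zero (\<open>disjoint_supports_orthogonal\<close>). The coefficient thus
  lives on the \<open>g\<close> that map some \<open>a \<in> A\<close> to some \<open>b \<in> B\<close>, and these form a finite union of left
  cosets of point stabilizers (\<open>coefficient_vanishes_at_infinity\<close>).

  Conversely, let \<open>V\<close> be a proper open subgroup. The group acts transitively on the countable set
  \<open>G/V\<close>, and so by unitaries without non-zero invariant vectors on the square-summable functions on
  \<open>G/V\<close>, restricted to those of mean zero if \<open>G/V\<close> is finite. For two distinct points \<open>x\<close> and
  \<open>y\<close> the coefficient of \<open>\<delta>\<^sub>x - \<delta>\<^sub>y\<close> with itself is at least 1 in modulus on the stabilizer of
  \<open>x\<close>, so that the Howe-Moore property bounds this stabilizer; for \<open>x = V\<close> it is \<open>V\<close>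
  (\<open>Howe_Moore_open_subgroup\<close>).

  From open subgroups to setwise stabilizers one needs that no non-empty finite set is invariant. As
  no point is fixed, such a set contains a finite orbit with two points \<open>a\<close> and \<open>b\<close>, which
  contradicts dissociation in the square-summable functions on \<open>\<Omega>\<close>: the function \<open>\<delta>\<^sub>a\<close> has the same inner products with all vectors fixed
  by \<open>G\<^sub>b\<close> as some invariant \<open>c\<close>. Testing against \<open>\<delta>\<^sub>b\<close> shows that \<open>c\<close> vanishes on the orbit,
  whereas testing against the indicator of the orbit shows that its values there sum to 1
  (\<open>no_invariant_finite_set\<close>). The remaining implications are inclusions of stabilizers.
\<close>

section \<open>Inner product spaces and closest points\<close>

text \<open>
  The axioms of a Hilbert space other than completeness. They are separated out because completeness
  refers to the distance, so that proving it for a concrete space already needs the triangle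
  inequality and the expansion of squared distances into inner products.
\<close>

locale complex_inner_space = Module.module complex_ring H
  for H :: "('h, 'm) inner_product_space_scheme" (structure) +
  assumes iprod_add: "\<lbrakk>x \<in> carrier H; y \<in> carrier H; z \<in> carrier H\<rbrakk> \<Longrightarrow>
      iprod H (x \<oplus> y) z = iprod H x z + iprod H y z"
    and iprod_smult: "\<lbrakk>x \<in> carrier H; y \<in> carrier H\<rbrakk> \<Longrightarrow> iprod H (c \<odot> x) y = c * iprod H x y"
    and iprod_commute: "\<lbrakk>x \<in> carrier H; y \<in> carrier H\<rbrakk> \<Longrightarrow> iprod H y x = cnj (iprod H x y)"
    and iprod_nonneg: "x \<in> carrier H \<Longrightarrow> 0 \<le> Re (iprod H x x)"
    and iprod_eq_zero: "\<lbrakk>x \<in> carrier H; iprod H x x = 0\<rbrakk> \<Longrightarrow> x = \<zero>"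
begin

definition hnorm :: "'h \<Rightarrow> real" where
  "hnorm x = sqrt (Re (iprod H x x))"

lemma smult_carrier [simp, intro]: "x \<in> carrier H \<Longrightarrow> c \<odot> x \<in> carrier H"
  by (rule smult_closed) (simp_all add: complex_ring_def)

lemma iprod_zero_left [simp]: "y \<in> carrier H \<Longrightarrow> iprod H \<zero> y = 0"
  using iprod_add[of \<zero> \<zero> y] by simp

lemma iprod_minus_left: "\<lbrakk>x \<in> carrier H; y \<in> carrier H\<rbrakk> \<Longrightarrow> iprod H (\<ominus> x) y = - iprod H x y"
  using iprod_add[of x "\<ominus> x" y] by (simp add: M.r_neg eq_neg_iff_add_eq_0 add.commute)

lemma iprod_diff_left:
  "\<lbrakk>x \<in> carrier H; y \<in> carrier H; z \<in> carrier H\<rbrakk> \<Longrightarrow> iprod H (x \<ominus> y) z = iprod H x z - iprod H y z"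
  by (simp add: a_minus_def iprod_add iprod_minus_left)

lemma iprod_zero_right [simp]: "y \<in> carrier H \<Longrightarrow> iprod H y \<zero> = 0"
  using iprod_commute[of \<zero> y] by simp

lemma iprod_add_right:
  "\<lbrakk>x \<in> carrier H; y \<in> carrier H; z \<in> carrier H\<rbrakk> \<Longrightarrow> iprod H z (x \<oplus> y) = iprod H z x + iprod H z y"
  by (metis M.add.m_closed complex_cnj_add iprod_add iprod_commute)

lemma iprod_diff_right:
  "\<lbrakk>x \<in> carrier H; y \<in> carrier H; z \<in> carrier H\<rbrakk> \<Longrightarrow> iprod H z (x \<ominus> y) = iprod H z x - iprod H z y"
  by (metis M.minus_closed complex_cnj_diff iprod_diff_left iprod_commute)

lemma iprod_smult_right:
  "\<lbrakk>x \<in> carrier H; y \<in> carrier H\<rbrakk> \<Longrightarrow> iprod H y (c \<odot> x) = cnj c * iprod H y x"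
  by (metis complex_cnj_mult iprod_commute iprod_smult smult_carrier)

lemmas iprod_linear = iprod_add iprod_smult iprod_minus_left iprod_diff_left
  iprod_add_right iprod_smult_right iprod_diff_right

lemma hnorm_nonneg [simp]: "x \<in> carrier H \<Longrightarrow> 0 \<le> hnorm x"
  by (simp add: hnorm_def iprod_nonneg)

lemma hnorm_square: "x \<in> carrier H \<Longrightarrow> (hnorm x)\<^sup>2 = Re (iprod H x x)"
  by (simp add: hnorm_def iprod_nonneg)

lemma iprod_self: "x \<in> carrier H \<Longrightarrow> iprod H x x = complex_of_real ((hnorm x)\<^sup>2)"
  using iprod_commute[of x x] by (simp add: hnorm_square complex_eq_iff)

lemma hnorm_eq_zero: "x \<in> carrier H \<Longrightarrow> hnorm x = 0 \<longleftrightarrow> x = \<zero>"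
  by (metis hnorm_def iprod_eq_zero iprod_self iprod_zero_left M.zero_closed of_real_0 power_zero_numeral
      real_sqrt_zero zero_complex.sel(1))

lemma hdist_eq_hnorm:
  "\<lbrakk>x \<in> carrier H; y \<in> carrier H\<rbrakk> \<Longrightarrow> hdist H x y = hnorm (x \<ominus> y)"
  by (simp add: hdist_def hnorm_def)

lemma hdist_square:
  "\<lbrakk>x \<in> carrier H; y \<in> carrier H\<rbrakk> \<Longrightarrow>
    (hdist H x y)\<^sup>2 = Re (iprod H x x) - 2 * Re (iprod H x y) + Re (iprod H y y)"
  using iprod_commute[of x y] by (simp add: hdist_eq_hnorm hnorm_square iprod_linear)

text \<open>
  Pythagoras for the component of \<open>x\<close> along \<open>y\<close>. Non-negativity of the left-hand side is the
  Cauchy-Schwarz inequality; minimality of a closest point makes the subtracted term vanish, which is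
  orthogonality.
\<close>

lemma hnorm_minus_component:
  assumes x: "x \<in> carrier H" and y: "y \<in> carrier H" "y \<noteq> \<zero>"
  shows "(hnorm (x \<ominus> (iprod H x y / iprod H y y) \<odot> y))\<^sup>2
    = (hnorm x)\<^sup>2 - (cmod (iprod H x y))\<^sup>2 / (hnorm y)\<^sup>2"
proof -
  define p where "p = iprod H x y"
  define c where "c = p / iprod H y y"
  have cy: "c * iprod H y y = p"
    using y iprod_eq_zero[of y] by (auto simp: c_def)
  have "iprod H (x \<ominus> c \<odot> y) (x \<ominus> c \<odot> y)
      = iprod H x x - cnj c * p - c * iprod H y x + cnj c * (c * iprod H y y)"
    using x y by (simp add: iprod_linear p_def right_diff_distrib)
  moreover have "c * iprod H y x = cnj c * p"
    using y iprod_commute[OF x y(1)] by (simp add: c_def p_def iprod_self[of y])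
  moreover have "cnj c * p = complex_of_real ((cmod p)\<^sup>2 / (hnorm y)\<^sup>2)"
    unfolding c_def iprod_self[OF y(1)] of_real_divide complex_norm_square by simp
  ultimately have "iprod H (x \<ominus> c \<odot> y) (x \<ominus> c \<odot> y)
      = iprod H x x - complex_of_real ((cmod p)\<^sup>2 / (hnorm y)\<^sup>2)"
    by (simp add: cy)
  then have "(hnorm (x \<ominus> c \<odot> y))\<^sup>2 = (hnorm x)\<^sup>2 - (cmod p)\<^sup>2 / (hnorm y)\<^sup>2"
    using x y by (simp only: hnorm_square M.minus_closed smult_carrier minus_complex.sel Re_complex_of_real)
  then show ?thesis by (simp add: c_def p_def)
qed

lemma Cauchy_Schwarz:
  assumes x: "x \<in> carrier H" and y: "y \<in> carrier H"
  shows "cmod (iprod H x y) \<le> hnorm x * hnorm y"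
proof (cases "y = \<zero>")
  case True
  then show ?thesis using x by (simp add: hnorm_def)
next
  case False
  then have ny: "(hnorm y)\<^sup>2 > 0" using y hnorm_eq_zero[of y] by simp
  have "(cmod (iprod H x y))\<^sup>2 / (hnorm y)\<^sup>2 \<le> (hnorm x)\<^sup>2"
    using hnorm_minus_component[OF x y False] by (smt (verit) zero_le_power2)
  then have "(cmod (iprod H x y))\<^sup>2 \<le> (hnorm x * hnorm y)\<^sup>2"
    using ny by (simp add: pos_divide_le_eq power_mult_distrib)
  then show ?thesis by (rule power2_le_imp_le) (use x y in simp)
qed

lemma hnorm_triangle:
  assumes "x \<in> carrier H" "y \<in> carrier H"
  shows "hnorm (x \<oplus> y) \<le> hnorm x + hnorm y"
proof (rule power2_le_imp_le)
  have "(hnorm (x \<oplus> y))\<^sup>2 = (hnorm x)\<^sup>2 + (hnorm y)\<^sup>2 + 2 * Re (iprod H x y)"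
    using assms iprod_commute[of x y] by (simp add: hnorm_square iprod_linear)
  moreover have "Re (iprod H x y) \<le> hnorm x * hnorm y"
    by (rule order_trans[OF complex_Re_le_cmod Cauchy_Schwarz[OF assms]])
  ultimately show "(hnorm (x \<oplus> y))\<^sup>2 \<le> (hnorm x + hnorm y)\<^sup>2"
    by (simp add: power2_sum)
qed (use assms in simp)

sublocale met: Metric_space "carrier H" "hdist H"
proof
  show "0 \<le> hdist H x y" for x y
    by (simp add: hdist_def iprod_nonneg)
  show "hdist H x y = hdist H y x" for x y
  proof (cases "x \<in> carrier H \<and> y \<in> carrier H")
    case True
    then have "iprod H (x \<ominus> y) (x \<ominus> y) = iprod H (y \<ominus> x) (y \<ominus> x)"
      by (simp add: iprod_linear)
    then show ?thesis by (simp add: hdist_def)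
  qed (auto simp: hdist_def)
  show "hdist H x y = 0 \<longleftrightarrow> x = y" if "x \<in> carrier H" "y \<in> carrier H" for x y
    using that M.minus_equality[of x "\<ominus> y"] M.r_neg[of y]
    by (auto simp: hdist_eq_hnorm hnorm_eq_zero a_minus_def)
  show "hdist H x z \<le> hdist H x y + hdist H y z"
    if "x \<in> carrier H" "y \<in> carrier H" "z \<in> carrier H" for x y z
  proof -
    have "(x \<ominus> y) \<oplus> (y \<ominus> z) = x \<ominus> z"
      using that by (simp add: a_minus_def M.a_assoc M.r_neg1)
    then show ?thesis
      using that hnorm_triangle[of "x \<ominus> y" "y \<ominus> z"] by (simp add: hdist_eq_hnorm)
  qed
qed

lemma htopology_eq: "htopology H = met.mtopology"
  by (simp add: htopology_def)

lemma hdist_zero: "x \<in> carrier H \<Longrightarrow> hdist H \<zero> x = hnorm x"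
  by (rule power2_eq_imp_eq) (simp_all add: hdist_square hnorm_square)

lemma iprod_Lipschitz:
  assumes "x \<in> carrier H" "y \<in> carrier H" "z \<in> carrier H"
  shows "cmod (iprod H x z - iprod H y z) \<le> hdist H x y * hnorm z"
  using assms Cauchy_Schwarz[of "x \<ominus> y" z] by (simp add: iprod_diff_left hdist_eq_hnorm)

text \<open>
  If two points of a convex set are almost closest to \<open>x\<close>, their midpoint is hardly closer than
  they are, so that this identity forces them to be near each other. Existence and uniqueness of closest points both come
  from it, and for that reason only midpoints, not arbitrary convex combinations, occur below.
\<close>

lemma Apollonius:
  assumes "x \<in> carrier H" "y \<in> carrier H" "z \<in> carrier H"
  shows "(hdist H y z)\<^sup>2 = 2 * (hdist H x y)\<^sup>2 + 2 * (hdist H x z)\<^sup>2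
           - 4 * (hdist H x ((1/2) \<odot> (y \<oplus> z)))\<^sup>2"
  using assms iprod_commute[of y z] iprod_commute[of y x] iprod_commute[of z x]
  by (simp add: hdist_square iprod_linear add_divide_distrib)

end

sublocale hilbert_space \<subseteq> complex_inner_space
  by unfold_locales (fact iprod_add iprod_smult iprod_commute iprod_nonneg iprod_eq_zero)+

context hilbert_space
begin

lemma closest_point_unique:
  assumes K: "K \<subseteq> carrier H" "\<And>y z. y \<in> K \<Longrightarrow> z \<in> K \<Longrightarrow> (1/2) \<odot> (y \<oplus> z) \<in> K"
    and x: "x \<in> carrier H"
    and y: "y \<in> K" "\<And>z. z \<in> K \<Longrightarrow> hdist H x y \<le> hdist H x z"
    and z: "z \<in> K" "hdist H x z \<le> hdist H x y"
  shows "z = y"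
proof -
  let ?m = "(1/2) \<odot> (y \<oplus> z)"
  have c: "y \<in> carrier H" "z \<in> carrier H" using K y z by auto
  have "hdist H x y \<le> hdist H x ?m" using K y z by blast
  then have "(hdist H x y)\<^sup>2 \<le> (hdist H x ?m)\<^sup>2" "(hdist H x z)\<^sup>2 \<le> (hdist H x y)\<^sup>2"
    using z by (auto intro: power_mono)
  then have "(hdist H y z)\<^sup>2 \<le> 0"
    using Apollonius[OF x c] by linarith
  then show ?thesis using c by simp
qed

lemma closest_point_exists:
  assumes K: "closedin met.mtopology K" "K \<noteq> {}"
    and mid: "\<And>y z. y \<in> K \<Longrightarrow> z \<in> K \<Longrightarrow> (1/2) \<odot> (y \<oplus> z) \<in> K"
    and x: "x \<in> carrier H"
  obtains y where "y \<in> K" "\<And>z. z \<in> K \<Longrightarrow> hdist H x y \<le> hdist H x z"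
proof -
  have KH: "K \<subseteq> carrier H" using K(1) closedin_subset by fastforce
  define d where "d = (INF z\<in>K. (hdist H x z)\<^sup>2)"
  have bdd: "bdd_below ((\<lambda>z. (hdist H x z)\<^sup>2) ` K)" by (rule bdd_belowI[of _ 0]) auto
  have dle: "d \<le> (hdist H x z)\<^sup>2" if "z \<in> K" for z
    unfolding d_def using bdd that by (rule cINF_lower)
  have "\<exists>y\<in>K. (hdist H x y)\<^sup>2 < d + e" if "e > 0" for e
    using cInf_lessD[of "(\<lambda>z. (hdist H x z)\<^sup>2) ` K" "d + e"] K(2) that by (auto simp: d_def)
  then have "\<forall>n. \<exists>y\<in>K. (hdist H x y)\<^sup>2 < d + 1 / real (Suc n)" by simp
  then obtain y where yK: "\<And>n. y n \<in> K" and y: "\<And>n. (hdist H x (y n))\<^sup>2 < d + 1 / real (Suc n)"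
    by metis
  have yH: "y n \<in> carrier H" for n using yK KH by auto
  have cauchy: "met.MCauchy y"
    unfolding met.MCauchy_def
  proof (intro conjI allI impI)
    show "range y \<subseteq> carrier H" using yH by auto
    fix e :: real assume e: "e > 0"
    then obtain N where N: "1 / real (Suc N) < e\<^sup>2 / 4"
      using nat_approx_posE[of "e\<^sup>2 / 4"] by auto
    show "\<exists>N. \<forall>n n'. N \<le> n \<longrightarrow> N \<le> n' \<longrightarrow> hdist H (y n) (y n') < e"
    proof (intro exI[of _ N] allI impI)
      fix n n' assume nn: "N \<le> n" "N \<le> n'"
      have s: "(hdist H x (y k))\<^sup>2 < d + e\<^sup>2 / 4" if "N \<le> k" for k
      proof -
        have "1 / real (Suc k) \<le> 1 / real (Suc N)" using that by (simp add: frac_le)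
        then show ?thesis using y[of k] N by linarith
      qed
      have "(hdist H (y n) (y n'))\<^sup>2 < e\<^sup>2"
        using Apollonius[OF x yH yH, of n n'] s[OF nn(1)] s[OF nn(2)] dle[OF mid[OF yK yK], of n n']
        by linarith
      then show "hdist H (y n) (y n') < e" using e by (simp add: power_less_imp_less_base)
    qed
  qed
  then obtain l where l: "limitin met.mtopology y l sequentially"
    using complete met.mcomplete_def by blast
  have lK: "l \<in> K"
    using limitin_closedin[OF l K(1)] yK by simp
  then have lH: "l \<in> carrier H" using KH by auto
  have lim: "(\<lambda>n. hdist H (y n) l) \<longlonglongrightarrow> 0"
    using l met.limitin_metric_dist_null by blast
  have "hdist H x l \<le> hdist H x z" if z: "z \<in> K" for z
  proof (rule field_le_epsilon)
    fix e :: real assume e: "e > 0"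
    have "(\<lambda>n. sqrt ((hdist H x z)\<^sup>2 + 1 / real (Suc n)) + hdist H (y n) l)
        \<longlonglongrightarrow> sqrt ((hdist H x z)\<^sup>2 + 0) + 0"
      by (intro tendsto_intros lim LIMSEQ_Suc[OF lim_1_over_n])
    moreover have "hdist H x l \<le> sqrt ((hdist H x z)\<^sup>2 + 1 / real (Suc n)) + hdist H (y n) l" for n
    proof -
      have "hdist H x (y n) \<le> sqrt ((hdist H x z)\<^sup>2 + 1 / real (Suc n))"
        using y[of n] dle[OF z] by (intro real_le_rsqrt) linarith
      then show ?thesis using met.triangle[OF x yH lH, of n] by linarith
    qed
    ultimately have "hdist H x l \<le> sqrt ((hdist H x z)\<^sup>2 + 0) + 0"
      using LIMSEQ_le_const by blast
    then show "hdist H x l \<le> hdist H x z + e" using e by simp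
  qed
  with lK show ?thesis using that by blast
qed

text \<open>
  The point \<open>y\<close> of \<open>S\<close> closest to \<open>x\<close> works: otherwise, moving \<open>y\<close> along a vector \<open>z\<close> of
  \<open>S\<close> by the component of \<open>x - y\<close> along \<open>z\<close> would bring it closer.
\<close>

lemma orthogonal_projection_exists:
  assumes S: "closedin met.mtopology S" "\<zero> \<in> S"
    and add: "\<And>y z. y \<in> S \<Longrightarrow> z \<in> S \<Longrightarrow> y \<oplus> z \<in> S"
    and smult: "\<And>c y. y \<in> S \<Longrightarrow> c \<odot> y \<in> S"
    and x: "x \<in> carrier H"
  obtains y where "y \<in> S" "\<And>z. z \<in> S \<Longrightarrow> iprod H (x \<ominus> y) z = 0"
proof -
  have SH: "S \<subseteq> carrier H" using S(1) closedin_subset by fastforce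
  obtain y where yS: "y \<in> S" and min: "\<And>z. z \<in> S \<Longrightarrow> hdist H x y \<le> hdist H x z"
    using closest_point_exists[of S x] S x add smult by blast
  have yH: "y \<in> carrier H" using yS SH by auto
  have "iprod H (x \<ominus> y) z = 0" if z: "z \<in> S" for z
  proof (cases "z = \<zero>")
    case True
    then show ?thesis using x yH by simp
  next
    case False
    have zH: "z \<in> carrier H" using z SH by auto
    then have nz: "(hnorm z)\<^sup>2 > 0" using False hnorm_eq_zero[of z] by simp
    let ?p = "iprod H (x \<ominus> y) z"
    let ?c = "?p / iprod H z z"
    have "(hdist H x y)\<^sup>2 \<le> (hdist H x (y \<oplus> ?c \<odot> z))\<^sup>2"
      using min[OF add[OF yS smult[OF z]]] by (intro power_mono) auto
    also have "\<dots> = (hnorm ((x \<ominus> y) \<ominus> ?c \<odot> z))\<^sup>2"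
      using x yH zH by (simp add: hdist_eq_hnorm hnorm_square iprod_linear algebra_simps)
    also have "\<dots> = (hdist H x y)\<^sup>2 - (cmod ?p)\<^sup>2 / (hnorm z)\<^sup>2"
      using hnorm_minus_component[of "x \<ominus> y" z] x yH zH False by (simp add: hdist_eq_hnorm)
    finally have "(cmod ?p)\<^sup>2 / (hnorm z)\<^sup>2 \<le> 0" by simp
    then show ?thesis using nz by (simp add: divide_le_0_iff)
  qed
  with yS show ?thesis using that by blast
qed

lemma orthogonal_projection_eqI:
  assumes "S \<subseteq> carrier H" "x \<in> carrier H"
    and add: "\<And>y z. y \<in> S \<Longrightarrow> z \<in> S \<Longrightarrow> y \<oplus> z \<in> S"
    and smult: "\<And>c y. y \<in> S \<Longrightarrow> c \<odot> y \<in> S"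
    and y: "y \<in> S" "\<And>z. z \<in> S \<Longrightarrow> iprod H (x \<ominus> y) z = 0"
  shows "orthogonal_projection H S x = y"
  unfolding orthogonal_projection_def
proof (rule the_equality)
  show "y \<in> S \<and> (\<forall>z\<in>S. iprod H (x \<ominus> y) z = 0)" using y by blast
  fix y' assume y': "y' \<in> S \<and> (\<forall>z\<in>S. iprod H (x \<ominus> y') z = 0)"
  have H: "y \<in> carrier H" "y' \<in> carrier H" using assms y' by auto
  define w where "w = y' \<oplus> (-1) \<odot> y"
  have w: "w \<in> S" unfolding w_def using add smult y y' by blast
  then have wH: "w \<in> carrier H" using assms by auto
  have "iprod H w w = iprod H (x \<ominus> y) w - iprod H (x \<ominus> y') w"
    using H wH assms(2) by (subst (1) w_def) (simp add: iprod_linear)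
  moreover have "iprod H w w = iprod H (y' \<ominus> y) (y' \<ominus> y)"
    using H by (simp add: w_def iprod_linear)
  ultimately have "iprod H (y' \<ominus> y) (y' \<ominus> y) = 0" using w y y' by simp
  then have "hdist H y' y = 0" using H by (simp add: hdist_def)
  then show "y' = y" using H by simp
qed

end

section \<open>Fixed vectors of unitary representations\<close>

locale unitary_rep = hilbert_space H for H :: "'h inner_product_space" (structure) +
  fixes G :: "('g, 'm) monoid_scheme" and T :: "'g topology" and \<pi> :: "'g \<Rightarrow> 'h \<Rightarrow> 'h"
  assumes group: "group G"
    and topspace: "topspace T = carrier G"
    and rep: "unitary_representation G T H \<pi>"
begin

lemma rep_unitary: "g \<in> carrier G \<Longrightarrow> \<pi> g \<in> carrier (unitary_group H)"
  using rep by (auto simp: unitary_representation_def hom_def)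

lemma rep_Bij: "g \<in> carrier G \<Longrightarrow> \<pi> g \<in> Bij (carrier H)"
  using rep_unitary by (simp add: unitary_group_def)

lemma rep_closed [simp, intro]: "\<lbrakk>g \<in> carrier G; x \<in> carrier H\<rbrakk> \<Longrightarrow> \<pi> g x \<in> carrier H"
  using rep_Bij Bij_imp_funcset by blast

lemma rep_add: "\<lbrakk>g \<in> carrier G; x \<in> carrier H; y \<in> carrier H\<rbrakk> \<Longrightarrow> \<pi> g (x \<oplus> y) = \<pi> g x \<oplus> \<pi> g y"
  using rep_unitary[of g] by (simp add: unitary_group_def)

lemma rep_smult: "\<lbrakk>g \<in> carrier G; x \<in> carrier H\<rbrakk> \<Longrightarrow> \<pi> g (c \<odot> x) = c \<odot> \<pi> g x"
  using rep_unitary[of g] by (simp add: unitary_group_def)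

lemma rep_iprod:
  "\<lbrakk>g \<in> carrier G; x \<in> carrier H; y \<in> carrier H\<rbrakk> \<Longrightarrow> iprod H (\<pi> g x) (\<pi> g y) = iprod H x y"
  using rep_unitary[of g] by (simp add: unitary_group_def)

lemma rep_mult:
  assumes "g \<in> carrier G" "h \<in> carrier G" "x \<in> carrier H"
  shows "\<pi> (g \<otimes>\<^bsub>G\<^esub> h) x = \<pi> g (\<pi> h x)"
proof -
  have "\<pi> (g \<otimes>\<^bsub>G\<^esub> h) = \<pi> g \<otimes>\<^bsub>unitary_group H\<^esub> \<pi> h"
    using rep assms by (simp add: unitary_representation_def hom_def)
  also have "\<dots> = compose (carrier H) (\<pi> g) (\<pi> h)"
    using assms rep_Bij by (simp add: unitary_group_def BijGroup_def)
  finally show ?thesis using assms by (simp add: compose_eq)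
qed

lemma rep_one: "x \<in> carrier H \<Longrightarrow> \<pi> \<one>\<^bsub>G\<^esub> x = x"
proof -
  assume x: "x \<in> carrier H"
  interpret G: group G by (rule group)
  have "\<pi> \<one>\<^bsub>G\<^esub> (\<pi> \<one>\<^bsub>G\<^esub> x) = \<pi> \<one>\<^bsub>G\<^esub> x" using x by (simp flip: rep_mult)
  moreover have "inj_on (\<pi> \<one>\<^bsub>G\<^esub>) (carrier H)"
    using rep_Bij[of "\<one>\<^bsub>G\<^esub>"] by (simp add: Bij_def bij_betw_def)
  ultimately show ?thesis using x by (meson G.one_closed inj_onD rep_closed)
qed

lemma rep_inv: "\<lbrakk>g \<in> carrier G; x \<in> carrier H\<rbrakk> \<Longrightarrow> \<pi> g (\<pi> (inv\<^bsub>G\<^esub> g) x) = x"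
  using group by (simp add: rep_one group.r_inv flip: rep_mult)

lemma rep_hdist:
  "\<lbrakk>g \<in> carrier G; x \<in> carrier H; y \<in> carrier H\<rbrakk> \<Longrightarrow> hdist H (\<pi> g x) (\<pi> g y) = hdist H x y"
  by (rule power2_eq_imp_eq) (simp_all add: hdist_square rep_iprod)

lemma rep_hnorm: "\<lbrakk>g \<in> carrier G; x \<in> carrier H\<rbrakk> \<Longrightarrow> hnorm (\<pi> g x) = hnorm x"
  by (simp add: hnorm_def rep_iprod)

lemma rep_continuous: "x \<in> carrier H \<Longrightarrow> continuous_map T met.mtopology (\<lambda>g. \<pi> g x)"
  using rep by (simp add: unitary_representation_def htopology_def)

lemma rep_zero: "g \<in> carrier G \<Longrightarrow> \<pi> g \<zero> = \<zero>"
  using rep_smult[of g \<zero> 0] by (metis M.zero_closed hnorm_eq_zero rep_closed rep_hnorm)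

text \<open>
  If \<open>g\<close> moves \<open>x\<close> by a distance \<open>d\<close>, then, \<open>g\<close> being an isometry, it moves every point at
  distance less than \<open>d/2\<close> from \<open>x\<close>.
\<close>

lemma fixed_vectors_closed: 
  assumes "K \<subseteq> carrier G"
  shows "closedin met.mtopology (fixed_vectors H \<pi> K)"
  unfolding met.closedin_metric
proof (intro conjI allI impI)
  show "fixed_vectors H \<pi> K \<subseteq> carrier H" by (auto simp: fixed_vectors_def)
  fix x assume "x \<in> carrier H - fixed_vectors H \<pi> K"
  then obtain g where x: "x \<in> carrier H" and g: "g \<in> K" "\<pi> g x \<noteq> x"
    by (auto simp: fixed_vectors_def)
  have gG: "g \<in> carrier G" using g assms by auto
  show "\<exists>r>0. disjnt (fixed_vectors H \<pi> K) (met.mball x r)"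
  proof (intro exI[of _ "hdist H (\<pi> g x) x / 2"] conjI)
    show "0 < hdist H (\<pi> g x) x / 2" using x gG g by (simp add: met.mdist_pos_less)
    show "disjnt (fixed_vectors H \<pi> K) (met.mball x (hdist H (\<pi> g x) x / 2))"
      unfolding disjnt_iff
    proof (intro allI notI, elim conjE)
      fix y assume y: "y \<in> fixed_vectors H \<pi> K" "y \<in> met.mball x (hdist H (\<pi> g x) x / 2)"
      then have yH: "y \<in> carrier H" and "\<pi> g y = y" using g by (auto simp: fixed_vectors_def)
      then have "hdist H (\<pi> g x) x \<le> hdist H x y + hdist H y x"
        using met.triangle[of "\<pi> g x" "\<pi> g y" x] rep_hdist[OF gG x yH] gG x by simp
      then show False using y(2) met.commute[of x y] by simp
    qed
  qed
qed

lemma fixed_vectors_subspace: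
  assumes "K \<subseteq> carrier G"
  shows "\<zero> \<in> fixed_vectors H \<pi> K"
    and "\<And>x y. \<lbrakk>x \<in> fixed_vectors H \<pi> K; y \<in> fixed_vectors H \<pi> K\<rbrakk> \<Longrightarrow> x \<oplus> y \<in> fixed_vectors H \<pi> K"
    and "\<And>c x. x \<in> fixed_vectors H \<pi> K \<Longrightarrow> c \<odot> x \<in> fixed_vectors H \<pi> K"
  using assms by (auto simp: fixed_vectors_def rep_zero rep_add rep_smult subset_iff)

lemma orthogonal_projection_fixed:
  assumes K: "K \<subseteq> carrier G" and x: "x \<in> carrier H"
  shows "orthogonal_projection H (fixed_vectors H \<pi> K) x \<in> fixed_vectors H \<pi> K"
    and "z \<in> fixed_vectors H \<pi> K \<Longrightarrow>
      iprod H (x \<ominus> orthogonal_projection H (fixed_vectors H \<pi> K) x) z = 0"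
proof -
  let ?S = "fixed_vectors H \<pi> K"
  note sub = fixed_vectors_subspace[OF K]
  obtain y where y: "y \<in> ?S" "\<And>z. z \<in> ?S \<Longrightarrow> iprod H (x \<ominus> y) z = 0"
    using orthogonal_projection_exists[OF fixed_vectors_closed[OF K] sub x] by blast
  have "?S \<subseteq> carrier H" by (auto simp: fixed_vectors_def)
  then have "orthogonal_projection H ?S x = y"
    by (rule orthogonal_projection_eqI[OF _ x sub(2,3) y])
  then show "orthogonal_projection H ?S x \<in> ?S"
    and "z \<in> ?S \<Longrightarrow> iprod H (x \<ominus> orthogonal_projection H ?S x) z = 0"
    using y by auto
qed

lemma orthogonal_projection_fixed_id:
  assumes K: "K \<subseteq> carrier G" and x: "x \<in> fixed_vectors H \<pi> K"
  shows "orthogonal_projection H (fixed_vectors H \<pi> K) x = x"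
proof -
  have S: "fixed_vectors H \<pi> K \<subseteq> carrier H" by (auto simp: fixed_vectors_def)
  have xH: "x \<in> carrier H" using x S by auto
  have "iprod H (x \<ominus> x) z = 0" if "z \<in> fixed_vectors H \<pi> K" for z
    using that S xH by (auto simp: iprod_linear)
  then show ?thesis
    by (intro orthogonal_projection_eqI[OF S xH fixed_vectors_subspace(2,3)[OF K] x])
qed

text \<open>
  The set \<open>K\<close> of all points within \<open>e\<close> of the whole orbit of \<open>x\<close> under \<open>L\<close> is closed, convex and
  invariant under \<open>L\<close>, and it contains \<open>x\<close>. As \<open>L\<close> acts by isometries fixing the origin, it
  fixes the unique element of \<open>K\<close> of smallest norm.
\<close>

lemma fixed_vector_near:
  assumes L: "subgroup L G" and x: "x \<in> carrier H"
    and e: "\<And>g. g \<in> L \<Longrightarrow> hdist H (\<pi> g x) x \<le> e"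
  obtains y where "y \<in> fixed_vectors H \<pi> L" "hdist H x y \<le> e"
proof -
  interpret G: group G by (rule group)
  interpret L: subgroup L G by (rule L)
  have LG: "g \<in> carrier G" if "g \<in> L" for g using that by (rule L.mem_carrier)
  have Lne: "L \<noteq> {}" using L.one_closed by blast
  define K where "K = (\<Inter>g\<in>L. met.mcball (\<pi> g x) e)"
  have memK: "z \<in> K \<longleftrightarrow> z \<in> carrier H \<and> (\<forall>g\<in>L. hdist H (\<pi> g x) z \<le> e)" for z
    using Lne x LG by (auto simp: K_def)
  have xK: "x \<in> K" using e x by (simp add: memK)
  have clos: "closedin met.mtopology K"
    unfolding K_def using Lne by (intro closedin_Inter) auto
  have mid: "(1/2) \<odot> (y \<oplus> z) \<in> K" if yz: "y \<in> K" "z \<in> K" for y z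
    unfolding memK
  proof (intro conjI ballI)
    show "(1/2) \<odot> (y \<oplus> z) \<in> carrier H" using yz by (simp add: memK)
    fix g assume g: "g \<in> L"
    have e0: "0 \<le> e" using e[OF g] met.nonneg order_trans by blast
    have "(hdist H (\<pi> g x) y)\<^sup>2 \<le> e\<^sup>2" "(hdist H (\<pi> g x) z)\<^sup>2 \<le> e\<^sup>2"
      using yz g by (auto simp: memK intro!: power_mono)
    then have "(hdist H (\<pi> g x) ((1/2) \<odot> (y \<oplus> z)))\<^sup>2 \<le> e\<^sup>2"
      using Apollonius[of "\<pi> g x" y z] yz x LG[OF g] zero_le_power2[of "hdist H y z"]
      by (simp add: memK)
    then show "hdist H (\<pi> g x) ((1/2) \<odot> (y \<oplus> z)) \<le> e"
      using e0 by (rule power2_le_imp_le)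
  qed
  obtain y where y: "y \<in> K" and min: "\<And>z. z \<in> K \<Longrightarrow> hdist H \<zero> y \<le> hdist H \<zero> z"
    using closest_point_exists[OF clos _ mid M.zero_closed] xK by blast
  have yH: "y \<in> carrier H" using y by (simp add: memK)
  have "\<pi> h y = y" if h: "h \<in> L" for h
  proof (rule closest_point_unique[of K])
    show "K \<subseteq> carrier H" by (auto simp: memK)
    show "\<pi> h y \<in> K" unfolding memK
    proof (intro conjI ballI)
      fix g assume g: "g \<in> L"
      have k: "inv\<^bsub>G\<^esub> h \<otimes>\<^bsub>G\<^esub> g \<in> L" using g h by auto
      have "\<pi> h (\<pi> (inv\<^bsub>G\<^esub> h \<otimes>\<^bsub>G\<^esub> g) x) = \<pi> g x"
        using x LG[OF g] LG[OF h] by (simp add: rep_mult rep_inv)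
      then have "hdist H (\<pi> g x) (\<pi> h y) = hdist H (\<pi> (inv\<^bsub>G\<^esub> h \<otimes>\<^bsub>G\<^esub> g) x) y"
        using rep_hdist[OF LG[OF h] _ yH, of "\<pi> (inv\<^bsub>G\<^esub> h \<otimes>\<^bsub>G\<^esub> g) x"] x LG[OF k] by simp
      then show "hdist H (\<pi> g x) (\<pi> h y) \<le> e" using y k by (simp add: memK)
    qed (use yH LG[OF h] in simp)
    show "hdist H \<zero> (\<pi> h y) \<le> hdist H \<zero> y"
      using yH LG[OF h] by (simp add: hdist_zero rep_hnorm)
  qed (use mid y min in auto)
  then have "y \<in> fixed_vectors H \<pi> L" using yH by (simp add: fixed_vectors_def)
  moreover have "hdist H x y \<le> e"
    using y L.one_closed x by (metis memK rep_one)
  ultimately show ?thesis using that by blast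
qed

lemma coefficient_continuous:
  assumes x: "x \<in> carrier H" and y: "y \<in> carrier H"
  shows "continuous_map T euclidean (\<lambda>g. iprod H (\<pi> g x) y)"
proof -
  have "continuous_map met.mtopology euclidean (\<lambda>z. iprod H z y)"
    unfolding mtopology_is_euclidean [symmetric]
    unfolding met.metric_continuous_map[OF Met_TC.Metric_space_axioms]
  proof (intro conjI ballI allI impI)
    fix a e assume a: "a \<in> carrier H" and e: "(0::real) < e"
    show "\<exists>d>0. \<forall>z. z \<in> carrier H \<and> hdist H a z < d \<longrightarrow> dist (iprod H a y) (iprod H z y) < e"
    proof (intro exI[of _ "e / (hnorm y + 1)"] conjI allI impI)
      have n: "0 \<le> hnorm y" using y by simp
      show "0 < e / (hnorm y + 1)" using e n by simp
      fix z assume z: "z \<in> carrier H \<and> hdist H a z < e / (hnorm y + 1)"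
      have "dist (iprod H a y) (iprod H z y) \<le> hdist H a z * hnorm y"
        using iprod_Lipschitz[of a z y] a z y by (simp add: dist_norm)
      also have "\<dots> \<le> hdist H a z * (hnorm y + 1)"
        by (intro mult_left_mono) auto
      also have "\<dots> < e" using z n by (simp add: pos_less_divide_eq)
      finally show "dist (iprod H a y) (iprod H z y) < e" .
    qed
  qed simp
  from continuous_map_compose[OF rep_continuous[OF x] this] show ?thesis
    by (simp add: o_def)
qed

end

section \<open>Coarsely bounded sets\<close>

lemma coarsely_boundedD:
  assumes "coarsely_bounded G T B" "ecart G \<delta>" "left_invariant G \<delta>"
    "continuous_map (prod_topology T T) euclideanreal (\<lambda>(x, y). \<delta> x y)"
  obtains C where "\<And>x y. x \<in> B \<Longrightarrow> y \<in> B \<Longrightarrow> \<delta> x y \<le> C"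
proof -
  have "\<exists>C. \<forall>x\<in>B. \<forall>y\<in>B. \<delta> x y \<le> C"
    using assms by (simp add: coarsely_bounded_def)
  then show ?thesis using that by blast
qed

lemma coarsely_bounded_subset:
  "coarsely_bounded G T B \<Longrightarrow> A \<subseteq> B \<Longrightarrow> coarsely_bounded G T A"
  unfolding coarsely_bounded_def by (meson subset_iff)

lemma coarsely_bounded_empty: "coarsely_bounded G T {}"
  by (simp add: coarsely_bounded_def)

text \<open>
  The union is bounded by going through one chosen point in each of the two sets. Since an ecart
  need not be symmetric, both distances between the chosen points enter the bound.
\<close>

lemma coarsely_bounded_Un:
  assumes A: "coarsely_bounded G T A" and B: "coarsely_bounded G T B"
  shows "coarsely_bounded G T (A \<union> B)"
proof (cases "A = {} \<or> B = {}")
  case True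
  then show ?thesis using A B by auto
next
  case False
  then obtain a b where a: "a \<in> A" and b: "b \<in> B" by auto
  have sub: "A \<subseteq> carrier G" "B \<subseteq> carrier G" using A B by (auto simp: coarsely_bounded_def)
  have "\<exists>C. \<forall>x\<in>A \<union> B. \<forall>y\<in>A \<union> B. \<delta> x y \<le> C"
    if d: "ecart G \<delta>" "left_invariant G \<delta>"
      "continuous_map (prod_topology T T) euclideanreal (\<lambda>(x, y). \<delta> x y)" for \<delta>
  proof -
    obtain C where C: "\<And>x y. x \<in> A \<Longrightarrow> y \<in> A \<Longrightarrow> \<delta> x y \<le> C"
      using coarsely_boundedD[OF A d] by blast
    obtain D where D: "\<And>x y. x \<in> B \<Longrightarrow> y \<in> B \<Longrightarrow> \<delta> x y \<le> D"
      using coarsely_boundedD[OF B d] by blast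
    have tri: "\<delta> x z \<le> \<delta> x y + \<delta> y z" if "x \<in> A \<union> B" "y \<in> A \<union> B" "z \<in> A \<union> B" for x y z
      using d(1) that sub unfolding ecart_def by blast
    have pos: "0 \<le> \<delta> x y" if "x \<in> A \<union> B" "y \<in> A \<union> B" for x y
      using d(1) that sub unfolding ecart_def by blast
    have C0: "0 \<le> C" using C[OF a a] pos[of a a] a by auto
    have D0: "0 \<le> D" using D[OF b b] pos[of b b] b by auto
    have ab: "0 \<le> \<delta> a b" "0 \<le> \<delta> b a" using pos a b by auto
    show ?thesis
    proof (intro exI ballI)
      fix x y assume x: "x \<in> A \<union> B" and y: "y \<in> A \<union> B"
      consider "x \<in> A" "y \<in> A" | "x \<in> B" "y \<in> B" | "x \<in> A" "y \<in> B" | "x \<in> B" "y \<in> A"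
        using x y by blast
      then show "\<delta> x y \<le> C + D + \<delta> a b + \<delta> b a"
      proof cases
        case 1
        then show ?thesis using C[of x y] C0 D0 ab by linarith
      next
        case 2
        then show ?thesis using D[of x y] C0 D0 ab by linarith
      next
        case 3
        then show ?thesis
          using C[of x a] D[of b y] tri[of x a y] tri[of a b y] a b ab by (simp add: C0 D0)
      next
        case 4
        then show ?thesis
          using D[of x b] C[of a y] tri[of x b y] tri[of b a y] a b ab by (simp add: C0 D0)
      qed
    qed
  qed
  then show ?thesis using sub by (simp add: coarsely_bounded_def)
qed

lemma coarsely_bounded_UN:
  assumes "finite I" "\<And>i. i \<in> I \<Longrightarrow> coarsely_bounded G T (B i)"
  shows "coarsely_bounded G T (\<Union>i\<in>I. B i)"
  using assms by (induction I) (auto intro: coarsely_bounded_Un coarsely_bounded_empty)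

lemma coarsely_bounded_left_translate:
  assumes "group G" "g \<in> carrier G" and B: "coarsely_bounded G T B"
  shows "coarsely_bounded G T (g <#\<^bsub>G\<^esub> B)"
proof -
  interpret group G by fact
  have sub: "B \<subseteq> carrier G" using B by (simp add: coarsely_bounded_def)
  have "\<exists>C. \<forall>x\<in>g <#\<^bsub>G\<^esub> B. \<forall>y\<in>g <#\<^bsub>G\<^esub> B. \<delta> x y \<le> C"
    if d: "ecart G \<delta>" "left_invariant G \<delta>"
      "continuous_map (prod_topology T T) euclideanreal (\<lambda>(x, y). \<delta> x y)" for \<delta>
  proof -
    obtain C where C: "\<And>x y. x \<in> B \<Longrightarrow> y \<in> B \<Longrightarrow> \<delta> x y \<le> C"
      using coarsely_boundedD[OF B d] by blast
    have "\<delta> (g \<otimes>\<^bsub>G\<^esub> x) (g \<otimes>\<^bsub>G\<^esub> y) \<le> C" if "x \<in> B" "y \<in> B" for x y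
      using d(2) C that sub assms(2) by (auto simp: left_invariant_def subset_iff)
    then show ?thesis by (auto simp: l_coset_def)
  qed
  then show ?thesis
    using sub assms(2) by (simp add: coarsely_bounded_def l_coset_subset_G)
qed

section \<open>Square-summable functions\<close>

text \<open>
  Since sums over infinite sets are 0 by convention, the last condition restricts the functions only
  for finite \<open>X\<close>. In both cases the result is the orthogonal complement of the square-summable
  constant functions, so that a group acting transitively on \<open>X\<close> fixes no non-zero vector of it.
\<close>

definition l2_functions :: "'x set \<Rightarrow> ('x \<Rightarrow> complex) set" where
  "l2_functions X = {f. (\<forall>x. x \<notin> X \<longrightarrow> f x = 0) \<and> (\<lambda>x. (cmod (f x))\<^sup>2) summable_on X
     \<and> (\<Sum>x\<in>X. f x) = 0}"

definition l2_iprod :: "'x set \<Rightarrow> ('x \<Rightarrow> complex) \<Rightarrow> ('x \<Rightarrow> complex) \<Rightarrow> complex" where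
  "l2_iprod X f g = (\<Sum>\<^sub>\<infinity>x\<in>X. f x * cnj (g x))"

lemma square_norm_add_le: "(cmod (a + b))\<^sup>2 \<le> 2 * (cmod a)\<^sup>2 + 2 * (cmod b)\<^sup>2"
proof -
  have "(cmod (a + b))\<^sup>2 \<le> (cmod a + cmod b)\<^sup>2"
    by (intro power_mono norm_triangle_ineq) auto
  also have "\<dots> \<le> 2 * (cmod a)\<^sup>2 + 2 * (cmod b)\<^sup>2"
    using sum_squares_bound[of "cmod a" "cmod b"] by (simp add: power2_sum)
  finally show ?thesis .
qed

lemma square_summable_add:
  assumes "(\<lambda>x. (cmod (f x))\<^sup>2) summable_on X" "(\<lambda>x. (cmod (g x))\<^sup>2) summable_on X"
  shows "(\<lambda>x. (cmod (f x + g x))\<^sup>2) summable_on X"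
proof (rule summable_on_comparison_test)
  show "(\<lambda>x. 2 * (cmod (f x))\<^sup>2 + 2 * (cmod (g x))\<^sup>2) summable_on X"
    using assms by (intro summable_on_add summable_on_cmult_right)
qed (use square_norm_add_le in auto)

lemma square_summable_mult:
  assumes "(\<lambda>x. (cmod (f x))\<^sup>2) summable_on X" "(\<lambda>x. (cmod (g x))\<^sup>2) summable_on X"
  shows "(\<lambda>x. f x * cnj (g x)) summable_on X"
proof (rule Infinite_Sum.abs_summable_summable, rule Infinite_Sum.abs_summable_on_comparison_test'[where g = "\<lambda>x. (cmod (f x))\<^sup>2 + (cmod (g x))\<^sup>2"])
  show "(\<lambda>x. (cmod (f x))\<^sup>2 + (cmod (g x))\<^sup>2) summable_on X"
    using assms by (intro summable_on_add)
  show "norm (f x * cnj (g x)) \<le> (cmod (f x))\<^sup>2 + (cmod (g x))\<^sup>2" for x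
  proof -
    have "0 \<le> cmod (f x) * cmod (g x)" by simp
    then show ?thesis
      using sum_squares_bound[of "cmod (f x)" "cmod (g x)"]
      unfolding norm_mult complex_mod_cnj by linarith
  qed
qed

lemma l2_functions_add:
  "\<lbrakk>f \<in> l2_functions X; g \<in> l2_functions X\<rbrakk> \<Longrightarrow> (\<lambda>x. f x + g x) \<in> l2_functions X"
  by (simp add: l2_functions_def square_summable_add sum.distrib)

lemma l2_functions_smult: "f \<in> l2_functions X \<Longrightarrow> (\<lambda>x. c * f x) \<in> l2_functions X"
  by (auto simp: l2_functions_def norm_mult power_mult_distrib summable_on_cmult_right
      simp flip: sum_distrib_left)

lemma l2_functions_zero: "(\<lambda>x. 0) \<in> l2_functions X"
  by (simp add: l2_functions_def)

lemma l2_functions_summable: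
  "\<lbrakk>f \<in> l2_functions X; g \<in> l2_functions X\<rbrakk> \<Longrightarrow> (\<lambda>x. f x * cnj (g x)) summable_on X"
  by (simp add: l2_functions_def square_summable_mult)

lemma l2_iprod_self:
  assumes "f \<in> l2_functions X"
  shows "l2_iprod X f f = complex_of_real (\<Sum>\<^sub>\<infinity>x\<in>X. (cmod (f x))\<^sup>2)"
proof -
  have "((\<lambda>x. complex_of_real ((cmod (f x))\<^sup>2)) has_sum complex_of_real (\<Sum>\<^sub>\<infinity>x\<in>X. (cmod (f x))\<^sup>2)) X"
    using assms by (intro has_sum_of_real) (simp add: l2_functions_def)
  then show ?thesis
    unfolding l2_iprod_def complex_norm_square by (rule infsumI)
qed

text \<open>
  A Cauchy sequence converges pointwise. The bounds on the partial sums over finite sets survive the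
  pointwise limit, and they give both membership of the limit and convergence in norm.
\<close>

lemma l2_functions_complete:
  fixes s :: "nat \<Rightarrow> 'x \<Rightarrow> complex"
  assumes s: "\<And>n. s n \<in> l2_functions X"
    and cauchy: "\<And>e. e > 0 \<Longrightarrow> \<exists>N. \<forall>n\<ge>N. \<forall>m\<ge>N. (\<Sum>\<^sub>\<infinity>x\<in>X. (cmod (s n x - s m x))\<^sup>2) < e"
  obtains f where "f \<in> l2_functions X"
    and "\<And>e. e > 0 \<Longrightarrow> \<exists>N. \<forall>n\<ge>N. (\<Sum>\<^sub>\<infinity>x\<in>X. (cmod (s n x - f x))\<^sup>2) \<le> e"
proof -
  have diff: "(\<lambda>x. s n x - s m x) \<in> l2_functions X" for n m
    using l2_functions_add[OF s[of n] l2_functions_smult[OF s[of m], of "-1"]] by simp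
  have le: "(\<Sum>x\<in>F. (cmod (s n x - s m x))\<^sup>2) \<le> (\<Sum>\<^sub>\<infinity>x\<in>X. (cmod (s n x - s m x))\<^sup>2)"
    if "finite F" "F \<subseteq> X" for F n m
    using diff[of n m] that by (intro finite_sum_le_infsum) (auto simp: l2_functions_def)
  have "convergent (\<lambda>n. s n x)" for x
  proof (cases "x \<in> X")
    case True
    have "Cauchy (\<lambda>n. s n x)"
    proof (rule CauchyI)
      fix e :: real assume e: "e > 0"
      then obtain N where N: "\<And>n m. n \<ge> N \<Longrightarrow> m \<ge> N \<Longrightarrow> (\<Sum>\<^sub>\<infinity>x\<in>X. (cmod (s n x - s m x))\<^sup>2) < e\<^sup>2"
        using cauchy[of "e\<^sup>2"] by auto
      have "cmod (s m x - s n x) < e" if "m \<ge> N" "n \<ge> N" for m n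
        using le[of "{x}" m n] N[OF that] True e power_less_imp_less_base[of "cmod (s m x - s n x)" 2 e]
        by simp
      then show "\<exists>M. \<forall>m\<ge>M. \<forall>n\<ge>M. norm (s m x - s n x) < e" by blast
    qed
    then show ?thesis by (rule Cauchy_convergent)
  next
    case False
    then have "(\<lambda>n. s n x) = (\<lambda>n. 0)" using s by (auto simp: l2_functions_def)
    then show ?thesis by (simp add: convergent_const)
  qed
  then obtain f :: "'x \<Rightarrow> complex" where f: "\<And>x. (\<lambda>n. s n x) \<longlonglongrightarrow> f x"
    unfolding convergent_def by metis
  have fX: "f x = 0" if "x \<notin> X" for x
    using f[of x] s that LIMSEQ_unique[of "\<lambda>n. 0::complex" "f x" 0]
    by (simp add: l2_functions_def)
  have bound: "(\<Sum>x\<in>F. (cmod (s n x - f x))\<^sup>2) \<le> e"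
    if N: "\<forall>n\<ge>N. \<forall>m\<ge>N. (\<Sum>\<^sub>\<infinity>x\<in>X. (cmod (s n x - s m x))\<^sup>2) < e"
      and n: "n \<ge> N" and F: "finite F" "F \<subseteq> X" for N n e F
  proof (rule LIMSEQ_le_const2)
    show "(\<lambda>m. \<Sum>x\<in>F. (cmod (s n x - s m x))\<^sup>2) \<longlonglongrightarrow> (\<Sum>x\<in>F. (cmod (s n x - f x))\<^sup>2)"
      by (intro tendsto_intros f)
    show "\<exists>N. \<forall>m\<ge>N. (\<Sum>x\<in>F. (cmod (s n x - s m x))\<^sup>2) \<le> e"
      using le[OF F, of n] N n by (meson less_imp_le order_trans)
  qed
  have sumd: "(\<lambda>x. (cmod (s n x - f x))\<^sup>2) summable_on X"
    if N: "\<forall>n\<ge>N. \<forall>m\<ge>N. (\<Sum>\<^sub>\<infinity>x\<in>X. (cmod (s n x - s m x))\<^sup>2) < e"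
      and n: "n \<ge> N" for N n e
    using bound[OF that] by (intro nonneg_bdd_above_summable_on) (auto intro!: bdd_aboveI[of _ e])
  have fl2: "f \<in> l2_functions X"
    unfolding l2_functions_def
  proof (intro CollectI conjI allI impI)
    show "f x = 0" if "x \<notin> X" for x using fX that .
    obtain N where N: "\<forall>n\<ge>N. \<forall>m\<ge>N. (\<Sum>\<^sub>\<infinity>x\<in>X. (cmod (s n x - s m x))\<^sup>2) < 1"
      using cauchy[of 1] by auto
    have "(\<lambda>x. (cmod (f x - s N x))\<^sup>2) summable_on X"
      using sumd[OF N order_refl] by (simp add: norm_minus_commute)
    then have "(\<lambda>x. (cmod ((f x - s N x) + s N x))\<^sup>2) summable_on X"
      using s[of N] by (intro square_summable_add) (auto simp: l2_functions_def)
    then show "(\<lambda>x. (cmod (f x))\<^sup>2) summable_on X" by simp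
    have "(\<lambda>n. \<Sum>x\<in>X. s n x) \<longlonglongrightarrow> (\<Sum>x\<in>X. f x)" by (intro tendsto_sum f)
    moreover have "(\<lambda>n. \<Sum>x\<in>X. s n x) = (\<lambda>n. 0)" using s by (auto simp: l2_functions_def)
    ultimately show "(\<Sum>x\<in>X. f x) = 0" using LIMSEQ_unique[of "\<lambda>n. 0::complex"] by auto
  qed
  have "\<exists>N. \<forall>n\<ge>N. (\<Sum>\<^sub>\<infinity>x\<in>X. (cmod (s n x - f x))\<^sup>2) \<le> e" if e: "e > 0" for e
  proof -
    obtain N where N: "\<forall>n\<ge>N. \<forall>m\<ge>N. (\<Sum>\<^sub>\<infinity>x\<in>X. (cmod (s n x - s m x))\<^sup>2) < e"
      using cauchy[OF e] by auto
    have "(\<Sum>\<^sub>\<infinity>x\<in>X. (cmod (s n x - f x))\<^sup>2) \<le> e" if "n \<ge> N" for n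
      using sumd[OF N that] bound[OF N that] by (intro infsum_le_finite_sums) auto
    then show ?thesis by blast
  qed
  with fl2 show ?thesis using that by blast
qed

text \<open>
  The Hilbert space is carried over along an injection \<open>j\<close> into the type \<open>'h\<close> that serves as the
  universe for representations. The multiplication and unit are arbitrary fillers required by the
  record type.
\<close>

definition l2_space :: "(('x \<Rightarrow> complex) \<Rightarrow> 'h) \<Rightarrow> 'x set \<Rightarrow> 'h inner_product_space" where
  "l2_space j X =
    (let F = l2_functions X; e = inv_into F j in
     \<lparr>carrier = j ` F, mult = (\<lambda>u v. u), one = j (\<lambda>x. 0),
      zero = j (\<lambda>x. 0), add = (\<lambda>u v. j (\<lambda>x. e u x + e v x)),
      smult = (\<lambda>c u. j (\<lambda>x. c * e u x)), iprod = (\<lambda>u v. l2_iprod X (e u) (e v))\<rparr>)"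

locale l2_embedding =
  fixes j :: "('x \<Rightarrow> complex) \<Rightarrow> 'h" and X :: "'x set"
  assumes inj: "inj_on j (l2_functions X)"
begin

abbreviation "L \<equiv> l2_space j X"

lemma l2_carrier: "carrier L = j ` l2_functions X"
  by (simp add: l2_space_def Let_def)

lemma l2_zero: "\<zero>\<^bsub>L\<^esub> = j (\<lambda>x. 0)"
  by (simp add: l2_space_def Let_def)

lemma l2_inv [simp]: "f \<in> l2_functions X \<Longrightarrow> inv_into (l2_functions X) j (j f) = f"
  using inj by (rule inv_into_f_f)

lemma l2_add: "\<lbrakk>f \<in> l2_functions X; g \<in> l2_functions X\<rbrakk> \<Longrightarrow> j f \<oplus>\<^bsub>L\<^esub> j g = j (\<lambda>x. f x + g x)"
  by (simp add: l2_space_def Let_def)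

lemma l2_smult: "f \<in> l2_functions X \<Longrightarrow> c \<odot>\<^bsub>L\<^esub> j f = j (\<lambda>x. c * f x)"
  by (simp add: l2_space_def Let_def)

lemma l2_iprod_eq:
  "\<lbrakk>f \<in> l2_functions X; g \<in> l2_functions X\<rbrakk> \<Longrightarrow> iprod L (j f) (j g) = l2_iprod X f g"
  by (simp add: l2_space_def Let_def)

lemma l2_inner_space: "complex_inner_space L"
proof -
  have ab: "abelian_group L"
  proof (rule abelian_groupI)
    fix u assume "u \<in> carrier L"
    then obtain f where f: "f \<in> l2_functions X" "u = j f" by (auto simp: l2_carrier)
    have "j (\<lambda>x. (-1) * f x) \<in> carrier L"
      using f l2_functions_smult[of f X "-1"] by (simp add: l2_carrier)
    moreover have "j (\<lambda>x. (-1) * f x) \<oplus>\<^bsub>L\<^esub> u = \<zero>\<^bsub>L\<^esub>"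
      using f l2_functions_smult[of f X "-1"] by (simp add: l2_add l2_zero)
    ultimately show "\<exists>v\<in>carrier L. v \<oplus>\<^bsub>L\<^esub> u = \<zero>\<^bsub>L\<^esub>" by blast
  qed (auto simp: l2_carrier l2_zero l2_add l2_functions_add l2_functions_zero add_ac)
  have cr: "cring complex_ring"
    by (intro cringI abelian_groupI comm_monoidI)
      (auto simp: complex_ring_def algebra_simps intro: exI[of _ "- _"])
  have mod: "Module.module complex_ring L"
    by (intro moduleI cr ab)
      (auto simp: l2_carrier l2_add l2_smult l2_functions_smult l2_functions_add complex_ring_def
        algebra_simps)
  show ?thesis
  proof (intro complex_inner_space.intro mod complex_inner_space_axioms.intro)
    fix u v w assume "u \<in> carrier L" "v \<in> carrier L" "w \<in> carrier L"
    then show "iprod L (u \<oplus>\<^bsub>L\<^esub> v) w = iprod L u w + iprod L v w"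
      by (auto simp: l2_carrier l2_add l2_iprod_eq l2_functions_add l2_iprod_def distrib_right
          infsum_add l2_functions_summable)
  next
    fix u v c assume "u \<in> carrier L" "v \<in> carrier L"
    then show "iprod L (c \<odot>\<^bsub>L\<^esub> u) v = c * iprod L u v"
      by (auto simp: l2_carrier l2_smult l2_iprod_eq l2_functions_smult l2_iprod_def mult.assoc
          infsum_cmult_right l2_functions_summable)
  next
    fix u v assume "u \<in> carrier L" "v \<in> carrier L"
    then show "iprod L v u = cnj (iprod L u v)"
      by (auto simp: l2_carrier l2_iprod_eq l2_iprod_def mult.commute simp flip: infsum_cnj)
  next
    fix u assume "u \<in> carrier L"
    then show "0 \<le> Re (iprod L u u)"
      by (auto simp: l2_carrier l2_iprod_eq l2_iprod_self intro!: infsum_nonneg)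
  next
    fix u assume "u \<in> carrier L" "iprod L u u = 0"
    then obtain f where f: "f \<in> l2_functions X" "u = j f" "(\<Sum>\<^sub>\<infinity>x\<in>X. (cmod (f x))\<^sup>2) = 0"
      by (auto simp: l2_carrier l2_iprod_eq l2_iprod_self)
    then have "(cmod (f x))\<^sup>2 = 0" if "x \<in> X" for x
      using that by (intro nonneg_infsum_le_0D[of "\<lambda>x. (cmod (f x))\<^sup>2" X]) (auto simp: l2_functions_def)
    then have "f = (\<lambda>x. 0)" using f(1) by (auto simp: l2_functions_def fun_eq_iff)
    then show "u = \<zero>\<^bsub>L\<^esub>" using f by (simp add: l2_zero)
  qed
qed

sublocale L: complex_inner_space L by (rule l2_inner_space)

lemma l2_hdist_square:
  assumes f: "f \<in> l2_functions X" and g: "g \<in> l2_functions X"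
  shows "(hdist L (j f) (j g))\<^sup>2 = (\<Sum>\<^sub>\<infinity>x\<in>X. (cmod (f x - g x))\<^sup>2)"
proof -
  have c: "j f \<in> carrier L" "j g \<in> carrier L" using f g by (auto simp: l2_carrier)
  have d: "(\<lambda>x. f x - g x) \<in> l2_functions X"
    using l2_functions_add[OF f l2_functions_smult[OF g, of "-1"]] by simp
  have "j (\<lambda>x. f x - g x) = j f \<oplus>\<^bsub>L\<^esub> (-1) \<odot>\<^bsub>L\<^esub> j g"
    using f g l2_functions_smult[OF g, of "-1"] by (simp add: l2_smult l2_add)
  then have "iprod L (j (\<lambda>x. f x - g x)) (j (\<lambda>x. f x - g x)) = iprod L (j f \<ominus>\<^bsub>L\<^esub> j g) (j f \<ominus>\<^bsub>L\<^esub> j g)"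
    using c by (simp add: L.iprod_linear)
  then have "(hdist L (j f) (j g))\<^sup>2 = Re (iprod L (j (\<lambda>x. f x - g x)) (j (\<lambda>x. f x - g x)))"
    using c by (simp add: L.hdist_eq_hnorm L.hnorm_square)
  then show ?thesis using d by (simp add: l2_iprod_eq l2_iprod_self)
qed

lemma l2_hilbert_space: "hilbert_space L"
proof (intro hilbert_space.intro hilbert_space_axioms.intro)
  show "Module.module complex_ring L" by (rule L.module_axioms)
  show "L.met.mcomplete"
    unfolding L.met.mcomplete_def
  proof (intro allI impI)
    fix u assume u: "L.met.MCauchy u"
    then have "range u \<subseteq> carrier L" by (simp add: L.met.MCauchy_def)
    then have "\<forall>n. \<exists>f. f \<in> l2_functions X \<and> u n = j f"
      unfolding l2_carrier by blast
    then obtain s where s: "\<And>n. s n \<in> l2_functions X" and us: "\<And>n. u n = j (s n)" by metis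
    obtain f where f: "f \<in> l2_functions X"
      and lim: "\<And>e. e > 0 \<Longrightarrow> \<exists>N. \<forall>n\<ge>N. (\<Sum>\<^sub>\<infinity>x\<in>X. (cmod (s n x - f x))\<^sup>2) \<le> e"
    proof (rule l2_functions_complete[OF s])
      fix e :: real assume e: "e > 0"
      then obtain N where N: "\<And>n m. n \<ge> N \<Longrightarrow> m \<ge> N \<Longrightarrow> hdist L (u n) (u m) < sqrt e"
        using u unfolding L.met.MCauchy_def by (meson real_sqrt_gt_zero)
      have "(hdist L (u n) (u m))\<^sup>2 < e" if "n \<ge> N" "m \<ge> N" for n m
        using N[OF that] e L.met.nonneg[of "u n" "u m"] power_strict_mono[of _ "sqrt e" 2] by fastforce
      then show "\<exists>N. \<forall>n\<ge>N. \<forall>m\<ge>N. (\<Sum>\<^sub>\<infinity>x\<in>X. (cmod (s n x - s m x))\<^sup>2) < e"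
        using s us l2_hdist_square by metis
    qed (use that in blast)
    have "limitin L.met.mtopology u (j f) sequentially"
      unfolding L.met.limit_metric_sequentially
    proof (intro conjI allI impI)
      show "j f \<in> carrier L" using f by (simp add: l2_carrier)
      fix e :: real assume e: "e > 0"
      then obtain N where N: "\<And>n. n \<ge> N \<Longrightarrow> (\<Sum>\<^sub>\<infinity>x\<in>X. (cmod (s n x - f x))\<^sup>2) \<le> e\<^sup>2 / 2"
        using lim[of "e\<^sup>2 / 2"] by auto
      have "hdist L (u n) (j f) < e" if "n \<ge> N" for n
      proof (rule power_less_imp_less_base)
        have "(hdist L (u n) (j f))\<^sup>2 \<le> e\<^sup>2 / 2"
          using N[OF that] by (simp only: us l2_hdist_square[OF s f])
        also have "\<dots> < e\<^sup>2" using e by simp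
        finally show "(hdist L (u n) (j f))\<^sup>2 < e\<^sup>2" .
      qed (use e in simp)
      then show "\<exists>N. \<forall>n\<ge>N. u n \<in> carrier L \<and> hdist L (u n) (j f) < e"
        using s us by (auto simp: l2_carrier)
    qed
    then show "\<exists>l. limitin L.met.mtopology u l sequentially" by blast
  qed
qed (rule L.iprod_add L.iprod_smult L.iprod_commute L.iprod_nonneg L.iprod_eq_zero; assumption)+

end

text \<open>
  A function on a countable set is determined by the rational points strictly below the real and
  imaginary parts of its values, hence by a set of natural numbers; there are as many of these as
  real numbers.
\<close>

lemma l2_functions_embed:
  fixes X :: "'x set"
  assumes X: "countable X" and universe: "(UNIV :: real set) \<lesssim> (UNIV :: 'h set)"
  obtains j :: "('x \<Rightarrow> complex) \<Rightarrow> 'h" where "inj_on j (l2_functions X)"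
proof -
  define code :: "('x \<Rightarrow> complex) \<Rightarrow> nat set" where
    "code f = {to_nat (to_nat_on X x, q, r) | x q r.
       x \<in> X \<and> real_of_rat q < Re (f x) \<and> real_of_rat r < Im (f x)}" for f
  have mem: "to_nat (to_nat_on X x, q, r) \<in> code f \<longleftrightarrow> real_of_rat q < Re (f x) \<and> real_of_rat r < Im (f x)"
    if "x \<in> X" for f x q r
    using that inj_on_to_nat_on[OF X] by (auto simp: code_def inj_on_def)
  have le: "Re (f x) \<le> Re (g x) \<and> Im (f x) \<le> Im (g x)" if eq: "code f = code g" and x: "x \<in> X" for f g x
  proof (intro conjI; rule ccontr)
    assume "\<not> Re (f x) \<le> Re (g x)"
    then obtain q where q: "Re (g x) < real_of_rat q" "real_of_rat q < Re (f x)"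
      using of_rat_dense by (meson not_le)
    obtain r where "real_of_rat r < Im (f x)"
      using of_rat_dense[of "Im (f x) - 1" "Im (f x)"] by auto
    then show False using mem[OF x, of q r f] mem[OF x, of q r g] q eq by auto
  next
    assume "\<not> Im (f x) \<le> Im (g x)"
    then obtain r where r: "Im (g x) < real_of_rat r" "real_of_rat r < Im (f x)"
      using of_rat_dense by (meson not_le)
    obtain q where "real_of_rat q < Re (f x)"
      using of_rat_dense[of "Re (f x) - 1" "Re (f x)"] by auto
    then show False using mem[OF x, of q r f] mem[OF x, of q r g] r eq by auto
  qed
  have inj_code: "inj_on code (l2_functions X)"
  proof (rule inj_onI)
    fix f g assume fg: "f \<in> l2_functions X" "g \<in> l2_functions X" "code f = code g"
    show "f = g"
    proof
      fix x
      show "f x = g x"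
      proof (cases "x \<in> X")
        case True
        then show ?thesis using le[OF fg(3)] le[OF fg(3)[symmetric]] by (intro complex_eqI) (auto intro: antisym)
      next
        case False
        then show ?thesis using fg by (simp add: l2_functions_def)
      qed
    qed
  qed
  have "(UNIV :: nat set set) \<lesssim> (UNIV :: 'h set)"
    using nat_sets_eqpoll_reals universe by (meson eqpoll_imp_lepoll lepoll_trans)
  then obtain i :: "nat set \<Rightarrow> 'h" where "inj i" by (auto simp: lepoll_def)
  then have "inj_on (i \<circ> code) (l2_functions X)"
    using inj_code by (intro comp_inj_on) (auto intro: inj_on_subset)
  then show ?thesis using that by blast
qed

section \<open>The representation of a group on square-summable functions\<close>

text \<open>
  The openness assumption says that the action on the discrete set \<open>X\<close> is continuous.
\<close>

locale l2_action = l2_embedding j X + group_action G X \<phi>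
  for j :: "('x \<Rightarrow> complex) \<Rightarrow> 'h" and X and G :: "('g, 'm) monoid_scheme" and \<phi> +
  fixes T :: "'g topology"
  assumes topspace: "topspace T = carrier G"
    and open_transporter: "\<lbrakk>x \<in> X; y \<in> X\<rbrakk> \<Longrightarrow> openin T {g \<in> carrier G. \<phi> g x = y}"
begin

definition translate :: "'g \<Rightarrow> ('x \<Rightarrow> complex) \<Rightarrow> 'x \<Rightarrow> complex" where
  "translate g f = (\<lambda>x. if x \<in> X then f (\<phi> (inv\<^bsub>G\<^esub> g) x) else 0)"

definition l2_rep :: "'g \<Rightarrow> 'h \<Rightarrow> 'h" where
  "l2_rep g = (\<lambda>u\<in>carrier L. j (translate g (inv_into (l2_functions X) j u)))"

lemma group_G: "group G"
  using group_hom group_hom.axioms(1) by blast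

lemma inv_carrier: "g \<in> carrier G \<Longrightarrow> inv\<^bsub>G\<^esub> g \<in> carrier G"
  using group_G by (simp add: group.inv_closed)

lemma action_inv:
  assumes "g \<in> carrier G" "x \<in> X"
  shows "\<phi> (inv\<^bsub>G\<^esub> g) (\<phi> g x) = x" "\<phi> g (\<phi> (inv\<^bsub>G\<^esub> g) x) = x"
proof -
  have *: "\<phi> (inv\<^bsub>G\<^esub> h) (\<phi> h x) = x" if "h \<in> carrier G" for h
    using orbit_sym_aux[OF that assms(2)] by simp
  show "\<phi> (inv\<^bsub>G\<^esub> g) (\<phi> g x) = x" by (rule *[OF assms(1)])
  show "\<phi> g (\<phi> (inv\<^bsub>G\<^esub> g) x) = x"
    using *[OF inv_carrier[OF assms(1)]] group_G assms(1) by (simp add: group.inv_inv)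
qed

lemma action_bij: "g \<in> carrier G \<Longrightarrow> bij_betw (\<phi> g) X X"
  using bij_prop0 by (simp add: Bij_def)

lemma action_closed: "g \<in> carrier G \<Longrightarrow> x \<in> X \<Longrightarrow> \<phi> g x \<in> X"
  using element_image by blast

lemma translate_closed:
  assumes g: "g \<in> carrier G" and f: "f \<in> l2_functions X"
  shows "translate g f \<in> l2_functions X"
proof -
  let ?h = "\<phi> (inv\<^bsub>G\<^esub> g)"
  have bij: "bij_betw ?h X X" by (rule action_bij[OF inv_carrier[OF g]])
  have "(\<lambda>x. (cmod (translate g f x))\<^sup>2) summable_on X \<longleftrightarrow> (\<lambda>x. (cmod (f (?h x)))\<^sup>2) summable_on X"
    by (intro summable_on_cong) (simp add: translate_def)
  also have "\<dots> \<longleftrightarrow> (\<lambda>x. (cmod (f x))\<^sup>2) summable_on X"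
    by (rule summable_on_reindex_bij_betw[OF bij])
  finally have "(\<lambda>x. (cmod (translate g f x))\<^sup>2) summable_on X"
    using f by (simp add: l2_functions_def)
  moreover have "(\<Sum>x\<in>X. translate g f x) = (\<Sum>x\<in>X. f x)"
    using sum.reindex_bij_betw[OF bij, of f] by (simp add: translate_def)
  ultimately show ?thesis using f by (simp add: l2_functions_def translate_def)
qed

lemma translate_iprod:
  assumes g: "g \<in> carrier G"
  shows "l2_iprod X (translate g f) (translate g k) = l2_iprod X f k"
proof -
  have "l2_iprod X (translate g f) (translate g k)
      = (\<Sum>\<^sub>\<infinity>x\<in>X. (\<lambda>x. f x * cnj (k x)) (\<phi> (inv\<^bsub>G\<^esub> g) x))"
    unfolding l2_iprod_def by (intro infsum_cong) (simp add: translate_def)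
  also have "\<dots> = l2_iprod X f k"
    unfolding l2_iprod_def
    by (rule infsum_reindex_bij_betw[OF action_bij[OF inv_carrier[OF g]]])
  finally show ?thesis .
qed

lemma translate_mult:
  assumes "g \<in> carrier G" "h \<in> carrier G"
  shows "translate (g \<otimes>\<^bsub>G\<^esub> h) f = translate g (translate h f)"
  using assms
  by (auto simp: translate_def fun_eq_iff group.inv_mult_group[OF group_G] composition_rule inv_carrier
      action_closed)

lemma translate_one: "f \<in> l2_functions X \<Longrightarrow> translate \<one>\<^bsub>G\<^esub> f = f"
  using monoid.inv_one[OF group.is_monoid[OF group_G]]
  by (auto simp: translate_def fun_eq_iff l2_functions_def simp flip: id_eq_one)

lemma l2_rep_apply:
  "f \<in> l2_functions X \<Longrightarrow> l2_rep g (j f) = j (translate g f)"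
  by (simp add: l2_rep_def l2_carrier)

lemma l2_rep_unitary:
  assumes g: "g \<in> carrier G"
  shows "l2_rep g \<in> carrier (unitary_group L)"
proof -
  have closed: "l2_rep h u \<in> carrier L" if "h \<in> carrier G" "u \<in> carrier L" for h u
    using that translate_closed by (auto simp: l2_carrier l2_rep_apply)
  have inv: "l2_rep h (l2_rep (inv\<^bsub>G\<^esub> h) u) = u" if "h \<in> carrier G" "u \<in> carrier L" for h u
    using that translate_closed group_G
    by (auto simp: l2_carrier l2_rep_apply inv_carrier translate_one group.r_inv simp flip: translate_mult)
  have "bij_betw (l2_rep g) (carrier L) (carrier L)"
  proof (rule bij_betw_byWitness[where f' = "l2_rep (inv\<^bsub>G\<^esub> g)"])
    show "\<forall>u\<in>carrier L. l2_rep (inv\<^bsub>G\<^esub> g) (l2_rep g u) = u"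
      using inv[OF inv_carrier[OF g]] g group_G by (simp add: group.inv_inv)
  qed (use closed inv g inv_carrier in auto)
  moreover have "l2_rep g \<in> extensional (carrier L)" by (simp add: l2_rep_def)
  ultimately have "l2_rep g \<in> Bij (carrier L)" by (simp add: Bij_def)
  moreover have "l2_rep g (u \<oplus>\<^bsub>L\<^esub> v) = l2_rep g u \<oplus>\<^bsub>L\<^esub> l2_rep g v"
    if uv: "u \<in> carrier L" "v \<in> carrier L" for u v
  proof -
    obtain f k where f: "f \<in> l2_functions X" "u = j f" and k: "k \<in> l2_functions X" "v = j k"
      using uv by (auto simp: l2_carrier)
    have "translate g (\<lambda>x. f x + k x) = (\<lambda>x. translate g f x + translate g k x)"
      by (auto simp: translate_def)
    then show ?thesis
      using f k translate_closed[OF g] by (simp add: l2_add l2_rep_apply l2_functions_add)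
  qed
  moreover have "l2_rep g (c \<odot>\<^bsub>L\<^esub> u) = c \<odot>\<^bsub>L\<^esub> l2_rep g u" if u: "u \<in> carrier L" for c u
  proof -
    obtain f where f: "f \<in> l2_functions X" "u = j f"
      using u by (auto simp: l2_carrier)
    have "translate g (\<lambda>x. c * f x) = (\<lambda>x. c * translate g f x)"
      by (auto simp: translate_def)
    then show ?thesis
      using f translate_closed[OF g] by (simp add: l2_smult l2_rep_apply l2_functions_smult)
  qed
  moreover have "iprod L (l2_rep g u) (l2_rep g v) = iprod L u v"
    if "u \<in> carrier L" "v \<in> carrier L" for u v
    using that translate_closed[OF g] translate_iprod[OF g]
    by (auto simp: l2_carrier l2_rep_apply l2_iprod_eq)
  ultimately show ?thesis by (simp add: unitary_group_def)
qed

text \<open>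
  The mass of a translate off the translated set equals the mass of \<open>f\<close> off \<open>F\<close>. This bound is
  uniform in \<open>g\<close>, which is what continuity needs.
\<close>

lemma translate_tail:
  assumes f: "f \<in> l2_functions X" and g: "g \<in> carrier G" and F: "F \<subseteq> X"
  shows "(\<lambda>x. (cmod (translate g f x))\<^sup>2) summable_on (X - \<phi> g ` F)"
    and "(\<Sum>\<^sub>\<infinity>x\<in>X - \<phi> g ` F. (cmod (translate g f x))\<^sup>2) = (\<Sum>\<^sub>\<infinity>x\<in>X - F. (cmod (f x))\<^sup>2)"
proof -
  show "(\<lambda>x. (cmod (translate g f x))\<^sup>2) summable_on (X - \<phi> g ` F)"
    using translate_closed[OF g f] by (auto simp: l2_functions_def intro: summable_on_subset[of _ X])
  have "bij_betw (\<phi> g) (X - F) (X - \<phi> g ` F)"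
    using action_bij[OF g] inj_on_image_set_diff[of "\<phi> g" X X F] F inj_on_subset[of "\<phi> g" X "X - F"]
    by (simp add: bij_betw_def)
  then have "(\<Sum>\<^sub>\<infinity>x\<in>X - \<phi> g ` F. (cmod (translate g f x))\<^sup>2)
      = (\<Sum>\<^sub>\<infinity>x\<in>X - F. (cmod (translate g f (\<phi> g x)))\<^sup>2)"
    by (rule infsum_reindex_bij_betw[symmetric])
  also have "\<dots> = (\<Sum>\<^sub>\<infinity>x\<in>X - F. (cmod (f x))\<^sup>2)"
    using g by (intro infsum_cong) (simp add: translate_def action_closed action_inv)
  finally show "(\<Sum>\<^sub>\<infinity>x\<in>X - \<phi> g ` F. (cmod (translate g f x))\<^sup>2) = (\<Sum>\<^sub>\<infinity>x\<in>X - F. (cmod (f x))\<^sup>2)" .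
qed

text \<open>
  Where \<open>g\<close> and \<open>h\<close> agree on \<open>F\<close>, the two translates agree on the image of \<open>F\<close>, and only the tails
  off this image contribute to the distance.
\<close>

lemma l2_rep_hdist_le:
  assumes f: "f \<in> l2_functions X" and g: "g \<in> carrier G" "h \<in> carrier G"
    and F: "F \<subseteq> X" "\<And>x. x \<in> F \<Longrightarrow> \<phi> g x = \<phi> h x"
  shows "(hdist L (l2_rep g (j f)) (l2_rep h (j f)))\<^sup>2 \<le> 4 * (\<Sum>\<^sub>\<infinity>x\<in>X - F. (cmod (f x))\<^sup>2)"
proof -
  let ?Y = "\<phi> g ` F"
  have Y: "?Y = \<phi> h ` F" using F(2) by (auto simp: image_iff)
  note sg = translate_tail[OF f g(1) F(1)] and sh = translate_tail[OF f g(2) F(1), folded Y]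
  have YX: "?Y \<subseteq> X" using F(1) g action_closed by auto
  have zero: "translate g f x = translate h f x" if "x \<in> ?Y" for x
  proof -
    obtain a where a: "a \<in> F" "x = \<phi> g a" "x = \<phi> h a" using \<open>x \<in> ?Y\<close> F(2) by auto
    then have aX: "a \<in> X" using F(1) by auto
    have "\<phi> (inv\<^bsub>G\<^esub> g) x = a" using action_inv(1)[OF g(1) aX] a by simp
    moreover have "\<phi> (inv\<^bsub>G\<^esub> h) x = a" using action_inv(1)[OF g(2) aX] a by simp
    ultimately show ?thesis by (simp add: translate_def)
  qed
  have bound: "(cmod (translate g f x - translate h f x))\<^sup>2
      \<le> 2 * (cmod (translate g f x))\<^sup>2 + 2 * (cmod (translate h f x))\<^sup>2" for x
    using square_norm_add_le[of "translate g f x" "- translate h f x"] by simp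
  have s: "(\<lambda>x. 2 * (cmod (translate g f x))\<^sup>2 + 2 * (cmod (translate h f x))\<^sup>2) summable_on (X - ?Y)"
    by (intro summable_on_add summable_on_cmult_right sg(1) sh(1))
  have "(hdist L (l2_rep g (j f)) (l2_rep h (j f)))\<^sup>2
      = (\<Sum>\<^sub>\<infinity>x\<in>X. (cmod (translate g f x - translate h f x))\<^sup>2)"
    using f g by (simp add: l2_rep_apply l2_hdist_square translate_closed)
  also have "\<dots> = (\<Sum>\<^sub>\<infinity>x\<in>X - ?Y. (cmod (translate g f x - translate h f x))\<^sup>2)"
    using zero by (intro infsum_cong_neutral) auto
  also have "\<dots> \<le> (\<Sum>\<^sub>\<infinity>x\<in>X - ?Y. 2 * (cmod (translate g f x))\<^sup>2 + 2 * (cmod (translate h f x))\<^sup>2)"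
    using bound s by (intro infsum_mono summable_on_comparison_test[OF s]) auto
  also have "\<dots> = 4 * (\<Sum>\<^sub>\<infinity>x\<in>X - F. (cmod (f x))\<^sup>2)"
    using sg sh by (simp add: infsum_add summable_on_cmult_right infsum_cmult_right)
  finally show ?thesis .
qed

lemma l2_rep_continuous:
  assumes "u \<in> carrier L"
  shows "continuous_map T (htopology L) (\<lambda>g. l2_rep g u)"
  unfolding L.htopology_eq L.met.continuous_map_to_metric
proof (intro ballI allI impI)
  obtain f where f: "f \<in> l2_functions X" "u = j f" using assms by (auto simp: l2_carrier)
  have sf: "(\<lambda>x. (cmod (f x))\<^sup>2) summable_on X" using f by (simp add: l2_functions_def)
  fix g e assume "g \<in> topspace T" and e: "0 < (e::real)"
  then have g: "g \<in> carrier G" by (simp add: topspace)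
  \<comment> \<open>The tail is multiplied by 4 in the bound for the distance, and the result has to stay below
    \<open>e\<^sup>2\<close>.\<close>
  obtain F where F: "finite F" "F \<subseteq> X"
    and d: "dist (\<Sum>x\<in>F. (cmod (f x))\<^sup>2) (\<Sum>\<^sub>\<infinity>x\<in>X. (cmod (f x))\<^sup>2) \<le> e\<^sup>2 / 8"
    using infsum_finite_approximation[OF sf, of "e\<^sup>2 / 8"] e by auto
  have "(\<Sum>\<^sub>\<infinity>x\<in>F \<union> (X - F). (cmod (f x))\<^sup>2)
      = (\<Sum>\<^sub>\<infinity>x\<in>F. (cmod (f x))\<^sup>2) + (\<Sum>\<^sub>\<infinity>x\<in>X - F. (cmod (f x))\<^sup>2)"
    using F sf by (intro infsum_Un_disjoint) (auto intro: summable_on_subset)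
  moreover have "F \<union> (X - F) = X" using F by auto
  ultimately have tail: "(\<Sum>\<^sub>\<infinity>x\<in>X - F. (cmod (f x))\<^sup>2) \<le> e\<^sup>2 / 8"
    using d F by (simp add: dist_real_def)
  define U where "U = (\<Inter>x\<in>F. {h \<in> carrier G. \<phi> h x = \<phi> g x}) \<inter> topspace T"
  show "\<exists>U. openin T U \<and> g \<in> U \<and> (\<forall>h\<in>U. l2_rep h u \<in> L.met.mball (l2_rep g u) e)"
  proof (intro exI[of _ U] conjI ballI)
    show "openin T U"
      unfolding U_def
      by (rule openin_INT[OF F(1)], rule open_transporter) (use F(2) g action_closed in auto)
    show "g \<in> U" using g by (simp add: U_def topspace)
    fix h assume "h \<in> U"
    then have h: "h \<in> carrier G" "\<And>x. x \<in> F \<Longrightarrow> \<phi> g x = \<phi> h x" by (auto simp: U_def topspace)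
    have "(hdist L (l2_rep g u) (l2_rep h u))\<^sup>2 \<le> 4 * (e\<^sup>2 / 8)"
      using l2_rep_hdist_le[OF f(1) g h(1) F(2) h(2)] tail f(2) by simp
    also have "\<dots> < e\<^sup>2" using e by simp
    finally have "hdist L (l2_rep g u) (l2_rep h u) < e"
      by (rule power_less_imp_less_base) (use e in simp)
    moreover have "l2_rep h u \<in> carrier L" if "h \<in> carrier G" for h
      using that f translate_closed by (auto simp: l2_rep_apply l2_carrier)
    ultimately show "l2_rep h u \<in> L.met.mball (l2_rep g u) e"
      using g h by (simp add: L.met.in_mball)
  qed
qed

lemma l2_unitary_representation: "unitary_representation G T L l2_rep"
  unfolding unitary_representation_def
proof (intro conjI ballI homI l2_hilbert_space l2_rep_unitary l2_rep_continuous)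
  fix g h assume gh: "g \<in> carrier G" "h \<in> carrier G"
  have "l2_rep (g \<otimes>\<^bsub>G\<^esub> h) = compose (carrier L) (l2_rep g) (l2_rep h)"
  proof (rule extensionalityI[of _ "carrier L"])
    show "l2_rep (g \<otimes>\<^bsub>G\<^esub> h) u = compose (carrier L) (l2_rep g) (l2_rep h) u" if "u \<in> carrier L" for u
    proof -
      obtain f where "f \<in> l2_functions X" "u = j f" using \<open>u \<in> carrier L\<close> by (auto simp: l2_carrier)
      then show ?thesis
        using gh that by (simp add: compose_eq l2_rep_apply translate_closed translate_mult)
    qed
  qed (simp_all add: l2_rep_def)
  then show "l2_rep (g \<otimes>\<^bsub>G\<^esub> h) = l2_rep g \<otimes>\<^bsub>unitary_group L\<^esub> l2_rep h"
    using l2_rep_unitary gh by (simp add: unitary_group_def BijGroup_def)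
qed

lemma l2_fixed_vector_invariant:
  assumes "f \<in> l2_functions X" "j f \<in> fixed_vectors L l2_rep K" "g \<in> K" "g \<in> carrier G" "x \<in> X"
  shows "f (\<phi> g x) = f x"
proof -
  have "translate g f = f"
    using assms translate_closed inj by (auto simp: fixed_vectors_def l2_rep_apply inj_on_def)
  then show ?thesis
    using assms action_closed action_inv(1) by (metis translate_def)
qed

text \<open>
  An invariant function is constant by transitivity. The constant is 0 because the function is
  square-summable if \<open>X\<close> is infinite, and because it has mean zero if \<open>X\<close> is finite.
\<close>

lemma l2_no_fixed_vectors:
  assumes trans: "\<And>x y. \<lbrakk>x \<in> X; y \<in> X\<rbrakk> \<Longrightarrow> \<exists>g\<in>carrier G. \<phi> g x = y"
  shows "fixed_vectors L l2_rep (carrier G) = {\<zero>\<^bsub>L\<^esub>}"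
proof (intro equalityI subsetI)
  fix u assume u: "u \<in> fixed_vectors L l2_rep (carrier G)"
  then obtain f where f: "f \<in> l2_functions X" "u = j f" by (auto simp: fixed_vectors_def l2_carrier)
  have const: "f x = f y" if "x \<in> X" "y \<in> X" for x y
    using trans[OF that] l2_fixed_vector_invariant[OF f(1)] u f(2) that by metis
  have "f x = 0" if x: "x \<in> X" for x
  proof (cases "finite X")
    case True
    have "(\<Sum>y\<in>X. f y) = (\<Sum>y\<in>X. f x)" by (intro sum.cong refl const x)
    then have "of_nat (card X) * f x = 0" using f(1) by (simp add: l2_functions_def)
    then show ?thesis using True x by auto
  next
    case False
    have "(\<lambda>y. (cmod (f y))\<^sup>2) summable_on X \<longleftrightarrow> (\<lambda>y. (cmod (f x))\<^sup>2) summable_on X"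
      by (rule summable_on_cong) (simp only: const[OF _ x])
    then have "(\<lambda>y. (cmod (f x))\<^sup>2) summable_on X" using f(1) by (simp add: l2_functions_def)
    then show ?thesis using infsum_diverge_constant[OF False, of "(cmod (f x))\<^sup>2"] by auto
  qed
  then have "f = (\<lambda>x. 0)" using f(1) by (auto simp: l2_functions_def fun_eq_iff)
  then show "u \<in> {\<zero>\<^bsub>L\<^esub>}" using f(2) by (simp add: l2_zero)
next
  fix u assume "u \<in> {\<zero>\<^bsub>L\<^esub>}"
  then show "u \<in> fixed_vectors L l2_rep (carrier G)"
    using l2_functions_zero[of X]
    by (auto simp: fixed_vectors_def l2_zero l2_carrier l2_rep_apply translate_def)
qed

lemma l2_iprod_finite:
  assumes "finite S" "S \<subseteq> X" "\<And>x. x \<notin> S \<Longrightarrow> k x = 0"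
  shows "l2_iprod X f k = (\<Sum>x\<in>S. f x * cnj (k x))"
proof -
  have "l2_iprod X f k = (\<Sum>\<^sub>\<infinity>x\<in>S. f x * cnj (k x))"
    unfolding l2_iprod_def using assms by (intro infsum_cong_neutral) auto
  then show ?thesis using assms by simp
qed

lemma finite_support_summable:
  assumes "finite S" "S \<subseteq> X" "\<And>x. x \<notin> S \<Longrightarrow> f x = 0"
  shows "(\<lambda>x. (cmod (f x))\<^sup>2) summable_on X"
proof -
  have "(\<lambda>x. (cmod (f x))\<^sup>2) summable_on X \<longleftrightarrow> (\<lambda>x. (cmod (f x))\<^sup>2) summable_on S"
    using assms by (intro summable_on_cong_neutral) auto
  then show ?thesis using assms by simp
qed

text \<open>
  The vector \<open>\<delta>\<^sub>x - \<delta>\<^sub>y\<close> has mean zero. If \<open>g\<close> fixes \<open>x\<close>, its translate takes the value 1 at \<open>x\<close>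
  and the value 0 or -1 at \<open>y\<close>, so its inner product with \<open>\<delta>\<^sub>x - \<delta>\<^sub>y\<close> is 1 or 2.
\<close>

lemma Howe_Moore_stabilizer_coarsely_bounded:
  assumes HM: "Howe_Moore TYPE('h) G T"
    and trans: "\<And>x y. \<lbrakk>x \<in> X; y \<in> X\<rbrakk> \<Longrightarrow> \<exists>g\<in>carrier G. \<phi> g x = y"
    and x: "x \<in> X" and y: "y \<in> X" "y \<noteq> x"
  shows "coarsely_bounded G T (stabilizer G \<phi> x)"
proof -
  define v :: "'x \<Rightarrow> complex" where "v z = (if z = x then 1 else if z = y then - 1 else 0)" for z
  have "(\<Sum>z\<in>X. v z) = (\<Sum>z\<in>{x, y}. v z)" if "finite X"
    using that x y by (intro sum.mono_neutral_right) (auto simp: v_def)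
  then have "(\<Sum>z\<in>X. v z) = 0" using y(2) by (cases "finite X") (auto simp: v_def)
  moreover have "(\<lambda>z. (cmod (v z))\<^sup>2) summable_on X"
    using x y by (intro finite_support_summable[of "{x, y}"]) (auto simp: v_def)
  ultimately have v: "v \<in> l2_functions X" using x y by (auto simp: l2_functions_def v_def)
  define c where "c g = iprod L (l2_rep g (j v)) (j v)" for g
  have "c \<in> C0 G T"
    using HM l2_unitary_representation l2_no_fixed_vectors[OF trans] v
    unfolding Howe_Moore_def c_def by (auto simp: l2_carrier)
  then have cb: "coarsely_bounded G T {g \<in> carrier G. 1 \<le> cmod (c g)}"
    by (simp add: C0_def vanishes_at_infinity_def)
  have "1 \<le> cmod (c g)" if "g \<in> stabilizer G \<phi> x" for g
  proof -
    have g: "g \<in> carrier G" "\<phi> g x = x" using that by (auto simp: stabilizer_def)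
    have "c g = translate g v x - translate g v y"
      using v g x y l2_iprod_finite[of "{x, y}" v "translate g v"]
      by (simp add: c_def l2_rep_apply l2_iprod_eq translate_closed v_def)
    moreover have "\<phi> (inv\<^bsub>G\<^esub> g) x = x" using action_inv(1)[OF g(1) x] g(2) by simp
    moreover have "\<phi> (inv\<^bsub>G\<^esub> g) y \<noteq> x" using action_inv(2)[OF g(1) y(1)] g(2) y(2) by metis
    ultimately have "1 \<le> Re (c g)" using x y by (auto simp: translate_def v_def)
    then show ?thesis using complex_Re_le_cmod[of "c g"] by linarith
  qed
  then have "stabilizer G \<phi> x \<subseteq> {g \<in> carrier G. 1 \<le> cmod (c g)}"
    by (auto simp: stabilizer_def)
  with cb show ?thesis by (rule coarsely_bounded_subset)
qed

end

section \<open>Permutation groups and the topology of pointwise convergence\<close>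

locale permutation_group =
  fixes \<Omega> :: "'a set" and G :: "('a \<Rightarrow> 'a) set"
  assumes subgroup_Bij: "subgroup G (BijGroup \<Omega>)"
begin

abbreviation "\<G> \<equiv> perm_group \<Omega> G"
abbreviation "T \<equiv> perm_topology \<Omega> G"

lemma carrier_perm [simp]: "carrier \<G> = G"
  by (simp add: perm_group_def)

lemma perm_Bij: "g \<in> G \<Longrightarrow> g \<in> Bij \<Omega>"
  using subgroup.subset[OF subgroup_Bij] by (auto simp: BijGroup_def)

sublocale G: group \<G>
  unfolding perm_group_def by (rule subgroup.subgroup_is_group[OF subgroup_Bij group_BijGroup])

sublocale act: group_action \<G> \<Omega> "\<lambda>g. g"
proof (intro group_action.intro group_hom.intro group_hom_axioms.intro homI)
  show "group \<G>" by (rule G.group_axioms)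
  show "group (BijGroup \<Omega>)" by (rule group_BijGroup)
  show "g \<in> carrier (BijGroup \<Omega>)" if "g \<in> carrier \<G>" for g
    using that perm_Bij by (simp add: BijGroup_def)
  show "g \<otimes>\<^bsub>\<G>\<^esub> h = g \<otimes>\<^bsub>BijGroup \<Omega>\<^esub> h" for g h
    by (simp add: perm_group_def)
qed

lemma perm_mult: "\<lbrakk>g \<in> G; h \<in> G; x \<in> \<Omega>\<rbrakk> \<Longrightarrow> (g \<otimes>\<^bsub>\<G>\<^esub> h) x = g (h x)"
  using act.composition_rule[of x g h] by simp

lemma perm_closed: "\<lbrakk>g \<in> G; x \<in> \<Omega>\<rbrakk> \<Longrightarrow> g x \<in> \<Omega>"
  using act.element_image by force

lemma perm_inv: "\<lbrakk>g \<in> G; x \<in> \<Omega>\<rbrakk> \<Longrightarrow> (inv\<^bsub>\<G>\<^esub> g) (g x) = x"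
  using act.orbit_sym_aux[of g x] by simp

lemma perm_one: "x \<in> \<Omega> \<Longrightarrow> \<one>\<^bsub>\<G>\<^esub> x = x"
  using act.id_eq_one by (metis restrict_apply')

lemma topspace_perm: "topspace T = G"
proof -
  have "G \<subseteq> Bij \<Omega>" using perm_Bij by (rule subsetI)
  moreover have "Bij \<Omega> \<subseteq> PiE \<Omega> (\<lambda>_. \<Omega>)"
    unfolding PiE_def using Bij_imp_funcset Bij_imp_extensional by blast
  ultimately show ?thesis
    unfolding perm_topology_def Sym_topology_def topspace_subtopology topspace_product_topology
      topspace_discrete_topology by blast
qed

lemma open_transporter_perm:
  assumes "x \<in> \<Omega>"
  shows "openin T {g \<in> G. g x = y}"
proof (cases "y \<in> \<Omega>")
  case True
  have "continuous_map T (discrete_topology \<Omega>) (\<lambda>g. g x)"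
    unfolding perm_topology_def Sym_topology_def
    by (intro continuous_map_from_subtopology continuous_map_product_projection assms)
  from openin_continuous_map_preimage[OF this, of "{y}"] show ?thesis
    using True by (simp add: topspace_perm)
next
  case False
  then have "{g \<in> G. g x = y} = {}" using perm_closed assms by auto
  then show ?thesis by (simp only: openin_empty)
qed

lemma perm_neighbourhood:
  assumes "openin T U" "g \<in> U"
  obtains A where "finite A" "A \<subseteq> \<Omega>" "\<And>h. h \<in> G \<Longrightarrow> (\<And>a. a \<in> A \<Longrightarrow> h a = g a) \<Longrightarrow> h \<in> U"
proof -
  let ?P = "product_topology (\<lambda>_. discrete_topology \<Omega>) \<Omega>"
  obtain W where W: "openin ?P W" "U = W \<inter> Bij \<Omega> \<inter> G"
    using assms(1) unfolding perm_topology_def Sym_topology_def openin_subtopology by blast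
  then obtain V where V: "finite {i \<in> \<Omega>. V i \<noteq> \<Omega>}" "g \<in> PiE \<Omega> V" "PiE \<Omega> V \<subseteq> W"
    using assms(2) unfolding openin_product_topology_alt by fastforce
  show ?thesis
  proof (rule that[of "{i \<in> \<Omega>. V i \<noteq> \<Omega>}"])
    fix h assume h: "h \<in> G" "\<And>a. a \<in> {i \<in> \<Omega>. V i \<noteq> \<Omega>} \<Longrightarrow> h a = g a"
    have "h i \<in> V i" if i: "i \<in> \<Omega>" for i
    proof (cases "V i = \<Omega>")
      case True
      then show ?thesis using perm_closed h(1) i by simp
    next
      case False
      then show ?thesis using h(2)[of i] i V(2) by (auto simp: PiE_def)
    qed
    moreover have "h \<in> extensional \<Omega>" using perm_Bij[OF h(1)] Bij_imp_extensional by blast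
    ultimately have "h \<in> PiE \<Omega> V" by (simp add: PiE_iff)
    then show "h \<in> U" using W(2) V(3) h(1) perm_Bij by auto
  qed (use V in auto)
qed

lemma perm_openI:
  assumes "V \<subseteq> G"
    and "\<And>g. g \<in> V \<Longrightarrow> \<exists>A. finite A \<and> A \<subseteq> \<Omega> \<and> (\<forall>h\<in>G. (\<forall>a\<in>A. h a = g a) \<longrightarrow> h \<in> V)"
  shows "openin T V"
proof (subst openin_subopen, intro ballI)
  fix g assume g: "g \<in> V"
  obtain A where A: "finite A" "A \<subseteq> \<Omega>" "\<forall>h\<in>G. (\<forall>a\<in>A. h a = g a) \<longrightarrow> h \<in> V"
    using assms(2)[OF g] by (elim exE conjE)
  have "openin T ((\<Inter>a\<in>A. {h \<in> G. h a = g a}) \<inter> topspace T)"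
    using A(2) by (intro openin_INT[OF A(1)] open_transporter_perm) auto
  moreover have "g \<in> (\<Inter>a\<in>A. {h \<in> G. h a = g a}) \<inter> topspace T"
    using g assms(1) by (auto simp: topspace_perm)
  moreover have "(\<Inter>a\<in>A. {h \<in> G. h a = g a}) \<inter> topspace T \<subseteq> V"
    using A(3) by (auto simp: topspace_perm)
  ultimately show "\<exists>U. openin T U \<and> g \<in> U \<and> U \<subseteq> V" by (intro exI conjI)
qed

lemma pointwise_stabilizer_subgroup:
  assumes "A \<subseteq> \<Omega>"
  shows "subgroup (pointwise_stabilizer G A) \<G>"
proof (rule G.subgroupI)
  show "pointwise_stabilizer G A \<noteq> {}"
    using assms perm_one G.one_closed by (auto simp: pointwise_stabilizer_def subset_iff)
  fix g assume g: "g \<in> pointwise_stabilizer G A"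
  then show "inv\<^bsub>\<G>\<^esub> g \<in> pointwise_stabilizer G A"
    using perm_inv[of g] assms G.inv_closed[of g] by (fastforce simp: pointwise_stabilizer_def)
  fix h assume "h \<in> pointwise_stabilizer G A"
  then show "g \<otimes>\<^bsub>\<G>\<^esub> h \<in> pointwise_stabilizer G A"
    using g assms G.m_closed[of g h] by (auto simp: pointwise_stabilizer_def perm_mult subset_iff)
qed (auto simp: pointwise_stabilizer_def)

lemma setwise_stabilizer_subgroup:
  assumes "A \<subseteq> \<Omega>"
  shows "subgroup (setwise_stabilizer G A) \<G>"
proof (rule G.subgroupI)
  have "\<one>\<^bsub>\<G>\<^esub> ` A = (\<lambda>a. a) ` A"
    using assms perm_one by (intro image_cong) auto
  then show "setwise_stabilizer G A \<noteq> {}"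
    using G.one_closed by (auto simp: setwise_stabilizer_def)
  fix g assume g: "g \<in> setwise_stabilizer G A"
  then have gA: "g \<in> G" "g ` A = A" by (auto simp: setwise_stabilizer_def)
  have "(\<lambda>a. (inv\<^bsub>\<G>\<^esub> g) (g a)) ` A = (\<lambda>a. a) ` A"
    using perm_inv[OF gA(1)] assms by (intro image_cong) auto
  then have "(inv\<^bsub>\<G>\<^esub> g) ` A = A"
    using gA(2) image_image[of "inv\<^bsub>\<G>\<^esub> g" g A] by simp
  then show "inv\<^bsub>\<G>\<^esub> g \<in> setwise_stabilizer G A"
    using g G.inv_closed[of g] by (simp add: setwise_stabilizer_def)
  fix h assume h: "h \<in> setwise_stabilizer G A"
  have hA: "h \<in> G" "h ` A = A" using h by (auto simp: setwise_stabilizer_def)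
  have "(g \<otimes>\<^bsub>\<G>\<^esub> h) ` A = (\<lambda>a. g (h a)) ` A"
    using perm_mult[OF gA(1) hA(1)] assms by (intro image_cong) auto
  then have "(g \<otimes>\<^bsub>\<G>\<^esub> h) ` A = A"
    using gA(2) hA(2) image_image[of g h A] by simp
  then show "g \<otimes>\<^bsub>\<G>\<^esub> h \<in> setwise_stabilizer G A"
    using g h G.m_closed[of g h] by (simp add: setwise_stabilizer_def)
qed (auto simp: setwise_stabilizer_def)

lemma setwise_stabilizer_open:
  assumes "finite A" "A \<subseteq> \<Omega>"
  shows "openin T (setwise_stabilizer G A)"
proof (rule perm_openI)
  fix g assume g: "g \<in> setwise_stabilizer G A"
  have "h \<in> setwise_stabilizer G A" if "h \<in> G" "\<forall>a\<in>A. h a = g a" for h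
  proof -
    have "h ` A = g ` A" using that by (intro image_cong) auto
    then show ?thesis using g that by (simp add: setwise_stabilizer_def)
  qed
  then show "\<exists>B. finite B \<and> B \<subseteq> \<Omega> \<and> (\<forall>h\<in>G. (\<forall>a\<in>B. h a = g a) \<longrightarrow> h \<in> setwise_stabilizer G A)"
    using assms by blast
qed (auto simp: setwise_stabilizer_def)

text \<open>
  Through this lemma a coset of an open subgroup depends only on finitely many values of its
  representative. It is the reason why there are countably many cosets and why the action on them is
  continuous.
\<close>

lemma coset_eq_if_agree:
  assumes V: "subgroup V \<G>" "pointwise_stabilizer G A \<subseteq> V" and A: "A \<subseteq> \<Omega>"
    and g: "g \<in> G" and h: "h \<in> G" and agree: "\<And>a. a \<in> A \<Longrightarrow> h a = g a"
  shows "h <#\<^bsub>\<G>\<^esub> V = g <#\<^bsub>\<G>\<^esub> V"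
proof -
  let ?k = "inv\<^bsub>\<G>\<^esub> g \<otimes>\<^bsub>\<G>\<^esub> h"
  have g': "inv\<^bsub>\<G>\<^esub> g \<in> G" using G.inv_closed[of g] g by simp
  have k: "?k \<in> G" using G.m_closed[of "inv\<^bsub>\<G>\<^esub> g" h] g' h by simp
  have "?k a = a" if "a \<in> A" for a
    using perm_mult[OF g' h, of a] agree[OF that] perm_inv[OF g, of a] A that by auto
  then have "?k \<in> V" using V(2) k by (auto simp: pointwise_stabilizer_def)
  then have "?k <#\<^bsub>\<G>\<^esub> V = V" using G.coset_join3[OF _ V(1), of ?k] k by simp
  moreover have "h = g \<otimes>\<^bsub>\<G>\<^esub> ?k" using g h g' by (simp add: G.m_assoc[symmetric])
  ultimately show ?thesis
    using G.lcos_m_assoc[of V g ?k] subgroup.subset[OF V(1)] g k by simp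
qed

end

section \<open>Dissociated permutation groups have no finite invariant sets\<close>

context permutation_group
begin

text \<open>
  Dissociation enters the proof only in this form. With \<open>p\<^sub>A \<xi> = \<xi>\<close>, the relation between the
  projections reads \<open>p\<^sub>B \<xi> = p\<^sub>A\<^sub>\<inter>\<^sub>B \<xi>\<close>, and this vector is \<open>\<zeta>\<close>: it is fixed by the stabilizer of
  \<open>A \<inter> B\<close>, and \<open>\<xi> - \<zeta>\<close> is orthogonal to the vectors fixed by \<open>G\<^sub>B\<close>.
\<close>

lemma dissociated_fixed_vectors:
  assumes rep: "unitary_representation \<G> T H \<pi>" and diss: "dissociated_representation \<Omega> G H \<pi>"
    and A: "finite A" "A \<subseteq> \<Omega>" and B: "finite B" "B \<subseteq> \<Omega>"
    and \<xi>: "\<xi> \<in> fixed_vectors H \<pi> (pointwise_stabilizer G A)"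
  obtains \<zeta> where "\<zeta> \<in> fixed_vectors H \<pi> (pointwise_stabilizer G (A \<inter> B))"
    and "\<And>\<eta>. \<eta> \<in> fixed_vectors H \<pi> (pointwise_stabilizer G B) \<Longrightarrow> iprod H \<xi> \<eta> = iprod H \<zeta> \<eta>"
proof -
  interpret unitary_rep H \<G> T \<pi>
    using rep G.group_axioms topspace_perm
    by (simp add: unitary_rep_def unitary_rep_axioms_def unitary_representation_def)
  have stab: "pointwise_stabilizer G C \<subseteq> carrier \<G>" for C
    by (auto simp: pointwise_stabilizer_def)
  have \<xi>H: "\<xi> \<in> carrier H" using \<xi> by (simp add: fixed_vectors_def)
  let ?p = "stabilizer_projection G H \<pi>"
  have "?p B \<xi> = ?p B (?p A \<xi>)"
    unfolding stabilizer_projection_def orthogonal_projection_fixed_id[OF stab \<xi>] ..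
  also have "\<dots> = ?p (A \<inter> B) \<xi>"
    using diss A B \<xi>H by (simp add: dissociated_representation_def Int_commute)
  finally have p: "?p B \<xi> = ?p (A \<inter> B) \<xi>" .
  have fix_H: "fixed_vectors H \<pi> K \<subseteq> carrier H" for K by (auto simp: fixed_vectors_def)
  have mem: "?p C \<xi> \<in> fixed_vectors H \<pi> (pointwise_stabilizer G C)" for C
    unfolding stabilizer_projection_def by (rule orthogonal_projection_fixed(1)[OF stab \<xi>H])
  show ?thesis
  proof (rule that[of "?p B \<xi>"])
    show "?p B \<xi> \<in> fixed_vectors H \<pi> (pointwise_stabilizer G (A \<inter> B))"
      unfolding p by (rule mem)
    fix \<eta> assume \<eta>: "\<eta> \<in> fixed_vectors H \<pi> (pointwise_stabilizer G B)"
    have "iprod H (\<xi> \<ominus>\<^bsub>H\<^esub> ?p B \<xi>) \<eta> = 0"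
      unfolding stabilizer_projection_def by (rule orthogonal_projection_fixed(2)[OF stab \<xi>H \<eta>])
    then show "iprod H \<xi> \<eta> = iprod H (?p B \<xi>) \<eta>"
      using \<xi>H \<eta> mem[of B] fix_H by (simp add: iprod_diff_left subset_iff)
  qed
qed

text \<open>
  Take \<open>a\<close> in an invariant finite set and \<open>b \<noteq> a\<close> in its orbit \<open>O'\<close>, which is finite. Apply
  dissociation to \<open>\<delta>\<^sub>a\<close> and the disjoint sets \<open>{a}\<close> and \<open>{b}\<close>: some invariant function \<open>c\<close> has the
  same inner products as \<open>\<delta>\<^sub>a\<close> with \<open>\<delta>\<^sub>b\<close> and with the indicator function of \<open>O'\<close>. By the first it
  vanishes at \<open>b\<close>, hence on \<open>O'\<close>; by the second its values on \<open>O'\<close> sum to 1.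
\<close>

lemma no_invariant_finite_set:
  assumes universe: "(UNIV :: real set) \<lesssim> (UNIV :: 'h set)"
    and \<Omega>: "countable \<Omega>" "infinite \<Omega>"
    and no_fixed_point: "\<forall>a\<in>\<Omega>. \<exists>g\<in>G. g a \<noteq> a"
    and diss: "dissociated_group TYPE('h) \<Omega> G"
    and A: "finite A" "A \<noteq> {}" "A \<subseteq> \<Omega>"
  shows "\<exists>g\<in>G. g ` A \<noteq> A"
proof (rule ccontr)
  assume "\<not> (\<exists>g\<in>G. g ` A \<noteq> A)"
  then have inv: "g ` A = A" if "g \<in> G" for g using that by blast
  obtain a where a: "a \<in> A" using A(2) by blast
  then have a\<Omega>: "a \<in> \<Omega>" using A(3) by blast
  obtain g where g: "g \<in> G" "g a \<noteq> a" using no_fixed_point a\<Omega> by blast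
  define b where "b = g a"
  define O' where "O' = orbit \<G> (\<lambda>g. g) a"
  have b\<Omega>: "b \<in> \<Omega>" using perm_closed[OF g(1) a\<Omega>] by (simp add: b_def)
  have OA: "O' \<subseteq> A"
    using inv a by (auto simp: O'_def orbit_def)
  then have O': "finite O'" "O' \<subseteq> \<Omega>" using A finite_subset by auto
  have aO: "a \<in> O'" using act.orbit_refl[OF a\<Omega>] by (simp add: O'_def)
  have O_inv: "h x \<in> O' \<longleftrightarrow> x \<in> O'" if h: "h \<in> G" and x: "x \<in> \<Omega>" for h x
  proof
    show "h x \<in> O'" if xO: "x \<in> O'"
    proof -
      obtain k where k: "k \<in> G" "x = k a" using xO by (auto simp: O'_def orbit_def)
      then have "h x = (h \<otimes>\<^bsub>\<G>\<^esub> k) a" using perm_mult[OF h k(1) a\<Omega>] by simp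
      then show ?thesis using G.m_closed[of h k] h k by (auto simp: O'_def orbit_def)
    qed
    show "x \<in> O'" if xO: "h x \<in> O'"
    proof -
      obtain k where k: "k \<in> G" "h x = k a" using xO by (auto simp: O'_def orbit_def)
      have h': "inv\<^bsub>\<G>\<^esub> h \<in> G" using G.inv_closed[of h] h by simp
      have "x = (inv\<^bsub>\<G>\<^esub> h \<otimes>\<^bsub>\<G>\<^esub> k) a"
        using perm_mult[OF h' k(1) a\<Omega>] perm_inv[OF h x] k(2) by simp
      then show ?thesis using G.m_closed[of "inv\<^bsub>\<G>\<^esub> h" k] h' k by (auto simp: O'_def orbit_def)
    qed
  qed
  obtain j :: "('a \<Rightarrow> complex) \<Rightarrow> 'h" where j: "inj_on j (l2_functions \<Omega>)"
    using l2_functions_embed[OF \<Omega>(1) universe] .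
  interpret l2: l2_action j \<Omega> \<G> "\<lambda>g. g" T
    using j open_transporter_perm topspace_perm
    by unfold_locales auto
  define ind :: "'a set \<Rightarrow> 'a \<Rightarrow> complex" where "ind S x = of_bool (x \<in> S)" for S x
  have ind_l2: "ind S \<in> l2_functions \<Omega>" if "finite S" "S \<subseteq> \<Omega>" for S
    using that \<Omega>(2) l2.finite_support_summable[of S "ind S"] by (auto simp: l2_functions_def ind_def)
  have ind_fixed: "j (ind S) \<in> fixed_vectors l2.L l2.l2_rep (pointwise_stabilizer G C)"
    if S: "finite S" "S \<subseteq> \<Omega>"
      and eq: "\<And>h x. \<lbrakk>h \<in> pointwise_stabilizer G C; x \<in> \<Omega>\<rbrakk> \<Longrightarrow> h x \<in> S \<longleftrightarrow> x \<in> S" for S C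
  proof -
    have "l2.translate h (ind S) = ind S" if h: "h \<in> pointwise_stabilizer G C" for h
    proof
      fix x
      have hG: "h \<in> G" using h by (simp add: pointwise_stabilizer_def)
      show "l2.translate h (ind S) x = ind S x"
      proof (cases "x \<in> \<Omega>")
        case True
        have "(inv\<^bsub>\<G>\<^esub> h) x \<in> \<Omega>" using perm_closed[of "inv\<^bsub>\<G>\<^esub> h"] G.inv_closed[of h] hG True by simp
        from eq[OF h this] show ?thesis
          using True hG l2.action_inv(2)[of h x] by (simp add: l2.translate_def ind_def)
      next
        case False
        then show ?thesis using S by (auto simp: l2.translate_def ind_def)
      qed
    qed
    then show ?thesis
      using ind_l2[OF S] by (simp add: fixed_vectors_def l2.l2_carrier l2.l2_rep_apply)
  qed
  have rep: "unitary_representation \<G> T l2.L l2.l2_rep" by (rule l2.l2_unitary_representation)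
  then have diss': "dissociated_representation \<Omega> G l2.L l2.l2_rep"
    using diss by (simp add: dissociated_group_def)
  have fa: "j (ind {a}) \<in> fixed_vectors l2.L l2.l2_rep (pointwise_stabilizer G {a})"
    using a\<Omega> l2.action_inv(1)
    by (intro ind_fixed) (auto simp: pointwise_stabilizer_def, metis carrier_perm l2.action_inv(1))
  have fb: "j (ind {b}) \<in> fixed_vectors l2.L l2.l2_rep (pointwise_stabilizer G {b})"
    using b\<Omega> l2.action_inv(1)
    by (intro ind_fixed) (auto simp: pointwise_stabilizer_def, metis carrier_perm l2.action_inv(1))
  have fO: "j (ind O') \<in> fixed_vectors l2.L l2.l2_rep (pointwise_stabilizer G {b})"
    by (intro ind_fixed O' O_inv) (auto simp: pointwise_stabilizer_def)
  obtain \<zeta> where \<zeta>: "\<zeta> \<in> fixed_vectors l2.L l2.l2_rep (pointwise_stabilizer G ({a} \<inter> {b}))"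
    and eq: "\<And>\<eta>. \<eta> \<in> fixed_vectors l2.L l2.l2_rep (pointwise_stabilizer G {b}) \<Longrightarrow>
      iprod l2.L (j (ind {a})) \<eta> = iprod l2.L \<zeta> \<eta>"
    using dissociated_fixed_vectors[OF rep diss' _ _ _ _ fa, of "{b}"] a\<Omega> b\<Omega> by auto
  obtain c where c: "c \<in> l2_functions \<Omega>" "\<zeta> = j c"
    using \<zeta> by (auto simp: fixed_vectors_def l2.l2_carrier)
  have ip: "iprod l2.L (j f) (j (ind S)) = (\<Sum>x\<in>S. f x)"
    if "f \<in> l2_functions \<Omega>" "finite S" "S \<subseteq> \<Omega>" for f S
    using that ind_l2 l2.l2_iprod_finite[of S "ind S" f] by (simp add: l2.l2_iprod_eq ind_def)
  have ab: "a \<noteq> b" using g by (simp add: b_def)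
  have "c b = ind {a} b"
    using eq[OF fb] ip[of c "{b}"] ip[of "ind {a}" "{b}"] c ind_l2[of "{a}"] a\<Omega> b\<Omega> by simp
  then have cb: "c b = 0" using ab by (simp add: ind_def)
  have c_inv: "c (h x) = c x" if "h \<in> G" "x \<in> \<Omega>" for h x
    using l2.l2_fixed_vector_invariant[OF c(1), of G h x] \<zeta> c(2) ab that
    by (simp add: pointwise_stabilizer_def)
  have ca: "c a = 0" using c_inv[OF g(1) a\<Omega>] cb by (simp add: b_def)
  have "c x = 0" if "x \<in> O'" for x
    using that c_inv[OF _ a\<Omega>] ca by (auto simp: O'_def orbit_def)
  then have "(\<Sum>x\<in>O'. c x) = 0" by simp
  moreover have "(\<Sum>x\<in>O'. c x) = (\<Sum>x\<in>O'. ind {a} x)"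
    using eq[OF fO] ip[of c O'] ip[of "ind {a}" O'] c ind_l2[of "{a}"] a\<Omega> O' by simp
  moreover have "(\<Sum>x\<in>O'. ind {a} x) = 1"
    using aO O'(1) by (simp add: ind_def of_bool_def)
  ultimately show False by simp
qed

end

section \<open>Open subgroups of groups with the Howe-Moore property\<close>

lemma (in group) coset_action:
  assumes V: "subgroup V G"
  shows "group_action G ((\<lambda>g. g <# V) ` carrier G) (\<lambda>g. \<lambda>C\<in>(\<lambda>g. g <# V) ` carrier G. g <# C)"
    (is "group_action G ?X ?\<phi>")
proof (intro group_action.intro group_hom.intro group_hom_axioms.intro homI)
  have VG: "V \<subseteq> carrier G" using V by (rule subgroup.subset)
  have app: "?\<phi> g (a <# V) = (g \<otimes> a) <# V" if "g \<in> carrier G" "a \<in> carrier G" for g a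
    using that VG by (simp add: lcos_m_assoc)
  have closed: "?\<phi> g C \<in> ?X" if "g \<in> carrier G" "C \<in> ?X" for g C
    using that app by fastforce
  have inv: "?\<phi> (inv g) (?\<phi> g C) = C" if g: "g \<in> carrier G" "C \<in> ?X" for g C
  proof -
    obtain a where a: "a \<in> carrier G" "C = a <# V" using g by auto
    have "?\<phi> (inv g) (?\<phi> g C) = (inv g \<otimes> (g \<otimes> a)) <# V"
      unfolding a(2) app[OF g(1) a(1)] using g a by (intro app) auto
    then show ?thesis using g a by (simp add: m_assoc[symmetric])
  qed
  show bij: "?\<phi> g \<in> carrier (BijGroup ?X)" if g: "g \<in> carrier G" for g
  proof -
    have "bij_betw (?\<phi> g) ?X ?X"
    proof (rule bij_betw_byWitness[where f' = "?\<phi> (inv g)"])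
      show "\<forall>C\<in>?X. ?\<phi> (inv g) (?\<phi> g C) = C" using inv[OF g] by blast
      show "\<forall>C\<in>?X. ?\<phi> g (?\<phi> (inv g) C) = C" using inv[of "inv g"] g by simp
      show "?\<phi> g ` ?X \<subseteq> ?X" using closed[OF g] by blast
      show "?\<phi> (inv g) ` ?X \<subseteq> ?X" using closed[of "inv g"] g by blast
    qed
    then show ?thesis by (simp add: BijGroup_def Bij_def)
  qed
  show "?\<phi> (g \<otimes> h) = ?\<phi> g \<otimes>\<^bsub>BijGroup ?X\<^esub> ?\<phi> h" if g: "g \<in> carrier G" and h: "h \<in> carrier G" for g h
  proof -
    have "?\<phi> (g \<otimes> h) = compose ?X (?\<phi> g) (?\<phi> h)"
    proof (rule extensionalityI[of _ ?X])
      fix C assume "C \<in> ?X"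
      then obtain a where a: "a \<in> carrier G" "C = a <# V" by auto
      show "?\<phi> (g \<otimes> h) C = compose ?X (?\<phi> g) (?\<phi> h) C"
        using g h a app[of "g \<otimes> h" a] app[of h a] app[of g "h \<otimes> a"]
        by (simp add: compose_eq m_assoc del: restrict_apply)
    qed auto
    then show ?thesis using bij[OF g] bij[OF h] by (simp add: BijGroup_def)
  qed
qed (rule group_axioms group_BijGroup)+

context permutation_group
begin

text \<open>
  \<open>V\<close> is a point stabilizer for the action on its left cosets, which are at least two in number
  because \<open>V\<close> is proper. Choosing a finite set whose pointwise stabilizer lies in \<open>V\<close> makes this a
  continuous action on a countable set.
\<close>

lemma Howe_Moore_open_subgroup:
  assumes universe: "(UNIV :: real set) \<lesssim> (UNIV :: 'h set)"
    and \<Omega>: "countable \<Omega>"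
    and HM: "Howe_Moore TYPE('h) \<G> T"
    and V: "subgroup V \<G>" "openin T V" "V \<noteq> G"
  shows "coarsely_bounded \<G> T V"
proof -
  have VG: "V \<subseteq> G" using subgroup.subset[OF V(1)] by simp
  have one: "\<one>\<^bsub>\<G>\<^esub> \<in> V" using V(1) by (rule subgroup.one_closed)
  obtain A where A: "finite A" "A \<subseteq> \<Omega>"
    and AV: "\<And>h. h \<in> G \<Longrightarrow> (\<And>a. a \<in> A \<Longrightarrow> h a = \<one>\<^bsub>\<G>\<^esub> a) \<Longrightarrow> h \<in> V"
    using perm_neighbourhood[OF V(2) one] by metis
  have stab: "pointwise_stabilizer G A \<subseteq> V"
    using AV A(2) perm_one by (auto simp: pointwise_stabilizer_def subset_iff)
  note agree = coset_eq_if_agree[OF V(1) stab A(2)]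
  let ?X = "(\<lambda>g. g <#\<^bsub>\<G>\<^esub> V) ` carrier \<G>"
  let ?\<phi> = "\<lambda>g. \<lambda>C\<in>?X. g <#\<^bsub>\<G>\<^esub> C"
  have app: "?\<phi> g (a <#\<^bsub>\<G>\<^esub> V) = (g \<otimes>\<^bsub>\<G>\<^esub> a) <#\<^bsub>\<G>\<^esub> V" if "g \<in> G" "a \<in> G" for g a
    using that VG by (simp add: G.lcos_m_assoc)
  have count: "countable ?X"
  proof (rule countable_subset)
    let ?P = "PiE A (\<lambda>_. \<Omega>)"
    \<comment> \<open>The coset of \<open>g\<close> is recovered from the restriction of \<open>g\<close> to \<open>A\<close> by choosing any extension.\<close>
    let ?F = "\<lambda>r. (SOME g. g \<in> G \<and> (\<forall>a\<in>A. g a = r a)) <#\<^bsub>\<G>\<^esub> V"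
    show "countable (?F ` ?P)"
      using A \<Omega> by (intro countable_image countable_PiE) auto
    show "?X \<subseteq> ?F ` ?P"
    proof
      fix C assume "C \<in> ?X"
      then obtain g where g: "g \<in> G" "C = g <#\<^bsub>\<G>\<^esub> V" by auto
      let ?r = "restrict g A"
      have "(SOME h. h \<in> G \<and> (\<forall>a\<in>A. h a = ?r a)) \<in> G
          \<and> (\<forall>a\<in>A. (SOME h. h \<in> G \<and> (\<forall>a\<in>A. h a = ?r a)) a = ?r a)"
        by (rule someI_ex[where P = "\<lambda>h. h \<in> G \<and> (\<forall>a\<in>A. h a = ?r a)"]) (use g in auto)
      then have "?F ?r = C" unfolding g(2) by (intro agree g(1)) auto
      moreover have "?r \<in> ?P" using A(2) perm_closed[OF g(1)] by auto
      ultimately show "C \<in> ?F ` ?P" by (rule image_eqI[OF sym])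
    qed
  qed
  obtain j :: "(('a \<Rightarrow> 'a) set \<Rightarrow> complex) \<Rightarrow> 'h" where j: "inj_on j (l2_functions ?X)"
    using l2_functions_embed[OF count universe] .
  have open_trans: "openin T {g \<in> carrier \<G>. ?\<phi> g C = D}" if CD: "C \<in> ?X" "D \<in> ?X" for C D
  proof (rule perm_openI)
    obtain a where a: "a \<in> G" "C = a <#\<^bsub>\<G>\<^esub> V" using CD by auto
    fix g assume g: "g \<in> {g \<in> carrier \<G>. ?\<phi> g C = D}"
    then have gG: "g \<in> G" by simp
    have "h \<in> {g \<in> carrier \<G>. ?\<phi> g C = D}" if h: "h \<in> G" "\<forall>x\<in>a ` A. h x = g x" for h
    proof -
      have "(h \<otimes>\<^bsub>\<G>\<^esub> a) <#\<^bsub>\<G>\<^esub> V = (g \<otimes>\<^bsub>\<G>\<^esub> a) <#\<^bsub>\<G>\<^esub> V"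
      proof (rule agree)
        show "g \<otimes>\<^bsub>\<G>\<^esub> a \<in> G" "h \<otimes>\<^bsub>\<G>\<^esub> a \<in> G"
          using G.m_closed[of g a] G.m_closed[of h a] gG h a by auto
        show "(h \<otimes>\<^bsub>\<G>\<^esub> a) x = (g \<otimes>\<^bsub>\<G>\<^esub> a) x" if "x \<in> A" for x
          using perm_mult[OF h(1) a(1), of x] perm_mult[OF gG a(1), of x] h(2) that A(2) by auto
      qed
      then have "?\<phi> h C = ?\<phi> g C" unfolding a(2) app[OF h(1) a(1)] app[OF gG a(1)] .
      then show ?thesis using g h by simp
    qed
    moreover have "finite (a ` A)" "a ` A \<subseteq> \<Omega>" using A perm_closed[OF a(1)] by auto
    ultimately show "\<exists>B. finite B \<and> B \<subseteq> \<Omega> \<and>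
        (\<forall>h\<in>G. (\<forall>x\<in>B. h x = g x) \<longrightarrow> h \<in> {g \<in> carrier \<G>. ?\<phi> g C = D})"
      by (intro exI[of _ "a ` A"]) blast
  qed auto
  interpret coset: group_action \<G> ?X ?\<phi> by (rule G.coset_action[OF V(1)])
  interpret l2: l2_action j ?X \<G> ?\<phi> T
    by unfold_locales (use j open_trans topspace_perm in auto)
  have Vcoset: "V = \<one>\<^bsub>\<G>\<^esub> <#\<^bsub>\<G>\<^esub> V" using VG G.lcos_mult_one[of V] by simp
  have VX: "V \<in> ?X" using Vcoset G.one_closed by blast
  obtain g where g: "g \<in> G" "g \<notin> V" using V(3) VG by blast
  have self: "h \<in> h <#\<^bsub>\<G>\<^esub> V" if "h \<in> G" for h
  proof -
    have "h \<otimes>\<^bsub>\<G>\<^esub> \<one>\<^bsub>\<G>\<^esub> \<in> h <#\<^bsub>\<G>\<^esub> V" using one unfolding l_coset_def by blast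
    then show ?thesis using that by simp
  qed
  have "g <#\<^bsub>\<G>\<^esub> V \<noteq> V" using self[OF g(1)] g(2) by auto
  moreover have "g <#\<^bsub>\<G>\<^esub> V \<in> ?X" using g(1) by auto
  moreover have "\<exists>h\<in>carrier \<G>. ?\<phi> h C = D" if CD: "C \<in> ?X" "D \<in> ?X" for C D
  proof -
    obtain a b where a: "a \<in> G" "C = a <#\<^bsub>\<G>\<^esub> V" and b: "b \<in> G" "D = b <#\<^bsub>\<G>\<^esub> V"
      using CD by auto
    have ab: "b \<otimes>\<^bsub>\<G>\<^esub> inv\<^bsub>\<G>\<^esub> a \<in> G"
      using a b G.m_closed[of b "inv\<^bsub>\<G>\<^esub> a"] G.inv_closed[of a] by simp
    have "b \<otimes>\<^bsub>\<G>\<^esub> inv\<^bsub>\<G>\<^esub> a \<otimes>\<^bsub>\<G>\<^esub> a = b"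
      using a(1) b(1) G.inv_closed[of a] by (simp add: G.m_assoc)
    then have "?\<phi> (b \<otimes>\<^bsub>\<G>\<^esub> inv\<^bsub>\<G>\<^esub> a) C = D"
      unfolding a(2) b(2) app[OF ab a(1)] by simp
    then show ?thesis using ab by auto
  qed
  ultimately have "coarsely_bounded \<G> T (stabilizer \<G> ?\<phi> V)"
    using l2.Howe_Moore_stabilizer_coarsely_bounded[OF HM _ VX] by blast
  moreover have "V \<subseteq> stabilizer \<G> ?\<phi> V"
    using VX VG G.coset_join3[OF _ V(1)] by (auto simp: stabilizer_def)
  ultimately show ?thesis by (rule coarsely_bounded_subset)
qed

end

section \<open>Coefficients vanish at infinity when point stabilizers are coarsely bounded\<close>

context permutation_group
begin

text \<open>
  The elements mapping \<open>a\<close> to \<open>b\<close> form a left coset of the stabilizer of \<open>a\<close>, or there are none.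
\<close>

lemma transporter_coarsely_bounded:
  assumes "a \<in> \<Omega>" and cb: "coarsely_bounded \<G> T (pointwise_stabilizer G {a})"
  shows "coarsely_bounded \<G> T {g \<in> G. g a = b}"
proof (cases "\<exists>h\<in>G. h a = b")
  case True
  then obtain h where h: "h \<in> G" "h a = b" by blast
  have "{g \<in> G. g a = b} \<subseteq> h <#\<^bsub>\<G>\<^esub> pointwise_stabilizer G {a}"
  proof
    fix g assume "g \<in> {g \<in> G. g a = b}"
    then have g: "g \<in> G" "g a = b" by auto
    have h': "inv\<^bsub>\<G>\<^esub> h \<in> G" using G.inv_closed[of h] h by simp
    have "inv\<^bsub>\<G>\<^esub> h \<otimes>\<^bsub>\<G>\<^esub> g \<in> pointwise_stabilizer G {a}"
      using G.m_closed[of "inv\<^bsub>\<G>\<^esub> h" g] h' g perm_mult[OF h' g(1) assms(1)] perm_inv[OF h(1) assms(1)] h(2)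
      by (simp add: pointwise_stabilizer_def)
    moreover have "g = h \<otimes>\<^bsub>\<G>\<^esub> (inv\<^bsub>\<G>\<^esub> h \<otimes>\<^bsub>\<G>\<^esub> g)"
      using g h h' by (simp add: G.m_assoc[symmetric])
    ultimately show "g \<in> h <#\<^bsub>\<G>\<^esub> pointwise_stabilizer G {a}" by (auto simp: l_coset_def)
  qed
  moreover have "coarsely_bounded \<G> T (h <#\<^bsub>\<G>\<^esub> pointwise_stabilizer G {a})"
    using h cb by (intro coarsely_bounded_left_translate G.group_axioms) auto
  ultimately show ?thesis by (meson coarsely_bounded_subset)
next
  case False
  then have "{g \<in> G. g a = b} = {}" by blast
  then show ?thesis by (simp only: coarsely_bounded_empty)
qed

end

locale permutation_rep = permutation_group \<Omega> G + unitary_rep H "perm_group \<Omega> G" "perm_topology \<Omega> G" \<pi>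
  for \<Omega> :: "'a set" and G and H :: "'h inner_product_space" (structure) and \<pi>
begin

text \<open>
  By continuity at the identity, \<open>\<xi>\<close> is moved by at most \<open>e\<close> by the elements of some pointwise
  stabilizer of a finite set.
\<close>

lemma fixed_vectors_dense:
  assumes \<xi>: "\<xi> \<in> carrier H" and e: "e > 0"
  obtains A \<xi>' where "finite A" "A \<subseteq> \<Omega>"
    and "\<xi>' \<in> fixed_vectors H \<pi> (pointwise_stabilizer G A)" "hdist H \<xi> \<xi>' \<le> e"
proof -
  have "\<one>\<^bsub>\<G>\<^esub> \<in> topspace T"
    using G.one_closed topspace_perm by simp
  with rep_continuous[OF \<xi>] e
  have "\<exists>U. openin T U \<and> \<one>\<^bsub>\<G>\<^esub> \<in> U \<and> (\<forall>g\<in>U. \<pi> g \<xi> \<in> met.mball (\<pi> \<one>\<^bsub>\<G>\<^esub> \<xi>) e)"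
    unfolding met.continuous_map_to_metric by (elim ballE allE impE) auto
  then obtain U where U: "openin T U" "\<one>\<^bsub>\<G>\<^esub> \<in> U"
    and ball: "\<And>g. g \<in> U \<Longrightarrow> \<pi> g \<xi> \<in> met.mball (\<pi> \<one>\<^bsub>\<G>\<^esub> \<xi>) e"
    by (elim exE conjE) (simp add: Ball_def)
  obtain A where A: "finite A" "A \<subseteq> \<Omega>"
    and AU: "\<And>h. h \<in> G \<Longrightarrow> (\<And>a. a \<in> A \<Longrightarrow> h a = \<one>\<^bsub>\<G>\<^esub> a) \<Longrightarrow> h \<in> U"
    using perm_neighbourhood[OF U] by metis
  have "hdist H (\<pi> g \<xi>) \<xi> \<le> e" if "g \<in> pointwise_stabilizer G A" for g
  proof -
    have "g \<in> U" using that A(2) perm_one by (intro AU) (auto simp: pointwise_stabilizer_def subset_iff)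
    then show ?thesis using ball[of g] \<xi> met.commute[of \<xi>] by (simp add: rep_one)
  qed
  from fixed_vector_near[OF pointwise_stabilizer_subgroup[OF A(2)] \<xi> this]
  show ?thesis using that A by blast
qed

text \<open>
  The vector \<open>\<pi> g \<xi>\<close> is fixed by the stabilizer of \<open>g(A)\<close>, since conjugation by \<open>g\<close> carries
  \<open>G\<^sub>A\<close> to it. By dissociation, against vectors fixed by \<open>G\<^sub>B\<close> it behaves like a vector fixed by the
  stabilizer of the empty set \<open>g(A) \<inter> B\<close>, that is by \<open>G\<close>; only 0 is.
\<close>

lemma disjoint_supports_orthogonal:
  assumes diss: "dissociated_representation \<Omega> G H \<pi>"
    and no_fixed: "fixed_vectors H \<pi> G = {\<zero>}"
    and A: "finite A" "A \<subseteq> \<Omega>" and B: "finite B" "B \<subseteq> \<Omega>" and g: "g \<in> G" "g ` A \<inter> B = {}"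
    and \<xi>: "\<xi> \<in> fixed_vectors H \<pi> (pointwise_stabilizer G A)"
    and \<eta>: "\<eta> \<in> fixed_vectors H \<pi> (pointwise_stabilizer G B)"
  shows "iprod H (\<pi> g \<xi>) \<eta> = 0"
proof -
  have H: "\<xi> \<in> carrier H" "\<eta> \<in> carrier H" using \<xi> \<eta> by (auto simp: fixed_vectors_def)
  have g': "inv\<^bsub>\<G>\<^esub> g \<in> G" using G.inv_closed[of g] g by simp
  have "\<pi> g \<xi> \<in> fixed_vectors H \<pi> (pointwise_stabilizer G (g ` A))"
    unfolding fixed_vectors_def
  proof (intro CollectI conjI ballI)
    show "\<pi> g \<xi> \<in> carrier H" using g H by simp
    fix h assume h: "h \<in> pointwise_stabilizer G (g ` A)"
    then have hG: "h \<in> G" by (simp add: pointwise_stabilizer_def)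
    let ?k = "inv\<^bsub>\<G>\<^esub> g \<otimes>\<^bsub>\<G>\<^esub> (h \<otimes>\<^bsub>\<G>\<^esub> g)"
    have hg: "h \<otimes>\<^bsub>\<G>\<^esub> g \<in> G" using G.m_closed[of h g] hG g by simp
    have k: "?k \<in> G" using G.m_closed[of "inv\<^bsub>\<G>\<^esub> g" "h \<otimes>\<^bsub>\<G>\<^esub> g"] g' hg by simp
    have "?k a = a" if "a \<in> A" for a
    proof -
      have "a \<in> \<Omega>" "h (g a) = g a" using h that A by (auto simp: pointwise_stabilizer_def)
      then show ?thesis using perm_mult[OF g' hg] perm_mult[OF hG g(1)] perm_inv[OF g(1)] by simp
    qed
    then have "?k \<in> pointwise_stabilizer G A" using k by (simp add: pointwise_stabilizer_def)
    then have "\<pi> ?k \<xi> = \<xi>" using \<xi> by (simp add: fixed_vectors_def)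
    then have "\<pi> g (\<pi> (inv\<^bsub>\<G>\<^esub> g) (\<pi> (h \<otimes>\<^bsub>\<G>\<^esub> g) \<xi>)) = \<pi> g \<xi>"
      using rep_mult[of "inv\<^bsub>\<G>\<^esub> g" "h \<otimes>\<^bsub>\<G>\<^esub> g" \<xi>] g' hg H by simp
    then show "\<pi> h (\<pi> g \<xi>) = \<pi> g \<xi>"
      using rep_inv[of g "\<pi> (h \<otimes>\<^bsub>\<G>\<^esub> g) \<xi>"] rep_mult[of h g \<xi>] g hG hg H by simp
  qed
  moreover have "finite (g ` A)" "g ` A \<subseteq> \<Omega>" using A perm_closed[OF g(1)] by auto
  ultimately obtain \<zeta> where "\<zeta> \<in> fixed_vectors H \<pi> (pointwise_stabilizer G (g ` A \<inter> B))"
    and eq: "iprod H (\<pi> g \<xi>) \<eta> = iprod H \<zeta> \<eta>"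
    using dissociated_fixed_vectors[OF rep diss _ _ B, of "g ` A" "\<pi> g \<xi>"] \<eta> by blast
  then have "\<zeta> = \<zero>" using no_fixed g(2) by (simp add: pointwise_stabilizer_def)
  then show ?thesis using eq H by simp
qed

text \<open>
  Replacing \<open>\<xi>\<close> and \<open>\<eta>\<close> by nearby vectors fixed by \<open>G\<^sub>A\<close> and \<open>G\<^sub>B\<close> changes the coefficient by at
  most \<open>e/2\<close>, uniformly in \<open>g\<close>. So it can reach \<open>e\<close> only where \<open>g(A)\<close> meets \<open>B\<close>.
\<close>

lemma coefficient_vanishes_at_infinity:
  assumes diss: "dissociated_representation \<Omega> G H \<pi>"
    and no_fixed: "fixed_vectors H \<pi> G = {\<zero>}"
    and stab: "\<forall>a\<in>\<Omega>. coarsely_bounded \<G> T (pointwise_stabilizer G {a})"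
    and \<xi>: "\<xi> \<in> carrier H" and \<eta>: "\<eta> \<in> carrier H"
  shows "vanishes_at_infinity \<G> T (\<lambda>g. iprod H (\<pi> g \<xi>) \<eta>)"
  unfolding vanishes_at_infinity_def
proof (intro allI impI)
  fix e :: real assume e: "e > 0"
  have n\<eta>: "0 \<le> hnorm \<eta>" using \<eta> by simp
  obtain A \<xi>' where A: "finite A" "A \<subseteq> \<Omega>"
    and \<xi>': "\<xi>' \<in> fixed_vectors H \<pi> (pointwise_stabilizer G A)" "hdist H \<xi> \<xi>' \<le> e / (4 * (hnorm \<eta> + 1))"
    using fixed_vectors_dense[OF \<xi>, of "e / (4 * (hnorm \<eta> + 1))"] e n\<eta> by auto
  have \<xi>'H: "\<xi>' \<in> carrier H" using \<xi>' by (simp add: fixed_vectors_def)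
  have n\<xi>': "0 \<le> hnorm \<xi>'" using \<xi>'H by simp
  \<comment> \<open>The quality of \<open>\<eta>'\<close> depends on the norm of \<open>\<xi>'\<close>, so \<open>\<xi>'\<close> has to be chosen first.\<close>
  obtain B \<eta>' where B: "finite B" "B \<subseteq> \<Omega>"
    and \<eta>': "\<eta>' \<in> fixed_vectors H \<pi> (pointwise_stabilizer G B)" "hdist H \<eta> \<eta>' \<le> e / (4 * (hnorm \<xi>' + 1))"
    using fixed_vectors_dense[OF \<eta>, of "e / (4 * (hnorm \<xi>' + 1))"] e n\<xi>' by auto
  have \<eta>'H: "\<eta>' \<in> carrier H" using \<eta>' by (simp add: fixed_vectors_def)
  have scale: "d * n \<le> e / 4" if "d \<le> e / (4 * (n + 1))" "0 \<le> n" for d n :: real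
  proof -
    have "d * n \<le> e / (4 * (n + 1)) * n" using that by (intro mult_right_mono) auto
    also have "\<dots> = e / 4 * (n / (n + 1))" using that by (simp add: field_simps)
    also have "\<dots> \<le> e / 4 * 1" using that e by (intro mult_left_mono) (auto simp: field_simps)
    finally show ?thesis by simp
  qed
  have small: "cmod (iprod H (\<pi> g \<xi>) \<eta>) < e" if g: "g \<in> G" "g ` A \<inter> B = {}" for g
  proof -
    have "cmod (iprod H (\<pi> g \<xi>) \<eta> - iprod H (\<pi> g \<xi>') \<eta>) \<le> hdist H \<xi> \<xi>' * hnorm \<eta>"
      using iprod_Lipschitz[of "\<pi> g \<xi>" "\<pi> g \<xi>'" \<eta>] g \<xi> \<xi>'H \<eta> by (simp add: rep_hdist)
    also have "\<dots> \<le> e / 4" using \<xi>'(2) n\<eta> by (rule scale)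
    finally have 1: "cmod (iprod H (\<pi> g \<xi>) \<eta> - iprod H (\<pi> g \<xi>') \<eta>) \<le> e / 4" .
    have "cmod (iprod H (\<pi> g \<xi>') \<eta> - iprod H (\<pi> g \<xi>') \<eta>')
        = cmod (cnj (iprod H \<eta> (\<pi> g \<xi>') - iprod H \<eta>' (\<pi> g \<xi>')))"
      using iprod_commute[of \<eta> "\<pi> g \<xi>'"] iprod_commute[of \<eta>' "\<pi> g \<xi>'"] g \<xi>'H \<eta> \<eta>'H by simp
    also have "\<dots> \<le> hdist H \<eta> \<eta>' * hnorm \<xi>'"
      using iprod_Lipschitz[of \<eta> \<eta>' "\<pi> g \<xi>'"] g \<xi>'H \<eta> \<eta>'H unfolding complex_mod_cnj by (simp add: rep_hnorm)
    also have "\<dots> \<le> e / 4" using \<eta>'(2) n\<xi>' by (rule scale)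
    finally have 2: "cmod (iprod H (\<pi> g \<xi>') \<eta> - iprod H (\<pi> g \<xi>') \<eta>') \<le> e / 4" .
    have 3: "iprod H (\<pi> g \<xi>') \<eta>' = 0"
      by (rule disjoint_supports_orthogonal[OF diss no_fixed A B g \<xi>'(1) \<eta>'(1)])
    have "cmod (iprod H (\<pi> g \<xi>) \<eta>) \<le> e / 4 + e / 4"
      using norm_triangle_ineq[of "iprod H (\<pi> g \<xi>) \<eta> - iprod H (\<pi> g \<xi>') \<eta>" "iprod H (\<pi> g \<xi>') \<eta>"]
        1 2 unfolding 3 by simp
    then show ?thesis using e by linarith
  qed
  have "coarsely_bounded \<G> T (\<Union>(a, b)\<in>A \<times> B. {g \<in> G. g a = b})"
    by (rule coarsely_bounded_UN) (use A B stab transporter_coarsely_bounded in auto)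
  moreover have "{g \<in> carrier \<G>. e \<le> cmod (iprod H (\<pi> g \<xi>) \<eta>)} \<subseteq> (\<Union>(a, b)\<in>A \<times> B. {g \<in> G. g a = b})"
  proof
    fix g assume "g \<in> {g \<in> carrier \<G>. e \<le> cmod (iprod H (\<pi> g \<xi>) \<eta>)}"
    then have g: "g \<in> G" and "\<not> cmod (iprod H (\<pi> g \<xi>) \<eta>) < e" by auto
    then have "g ` A \<inter> B \<noteq> {}" using small by blast
    then obtain a where "a \<in> A" "g a \<in> B" by auto
    then show "g \<in> (\<Union>(a, b)\<in>A \<times> B. {g \<in> G. g a = b})" using g by auto
  qed
  ultimately show "coarsely_bounded \<G> T {g \<in> carrier \<G>. e \<le> cmod (iprod H (\<pi> g \<xi>) \<eta>)}"
    by (rule coarsely_bounded_subset)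
qed

end

section \<open>The equivalence\<close>

theorem theorem2p11:
  fixes \<Omega> :: "'a set" and G :: "('a \<Rightarrow> 'a) set"
  defines "\<G> \<equiv> perm_group \<Omega> G" and "T \<equiv> perm_topology \<Omega> G"
  assumes universe: "(UNIV :: real set) \<lesssim> (UNIV :: 'h set)"
    and "countable \<Omega>" and "infinite \<Omega>"
    and "closed_permutation_group \<Omega> G"
    and no_fixed_point: "\<forall>a\<in>\<Omega>. \<exists>g\<in>G. g a \<noteq> a"
    and "dissociated_group TYPE('h) \<Omega> G"
  shows
   "(Howe_Moore TYPE('h) \<G> T
       \<longleftrightarrow> (\<forall>V. subgroup V \<G> \<and> openin T V \<and> V \<noteq> G \<longrightarrow> coarsely_bounded \<G> T V)) \<and>
    ((\<forall>V. subgroup V \<G> \<and> openin T V \<and> V \<noteq> G \<longrightarrow> coarsely_bounded \<G> T V)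
       \<longleftrightarrow> (\<forall>A. finite A \<and> A \<noteq> {} \<and> A \<subseteq> \<Omega> \<longrightarrow> coarsely_bounded \<G> T (setwise_stabilizer G A))) \<and>
    ((\<forall>A. finite A \<and> A \<noteq> {} \<and> A \<subseteq> \<Omega> \<longrightarrow> coarsely_bounded \<G> T (setwise_stabilizer G A))
       \<longleftrightarrow> (\<forall>A. finite A \<and> A \<noteq> {} \<and> A \<subseteq> \<Omega> \<longrightarrow> coarsely_bounded \<G> T (pointwise_stabilizer G A))) \<and>
    ((\<forall>A. finite A \<and> A \<noteq> {} \<and> A \<subseteq> \<Omega> \<longrightarrow> coarsely_bounded \<G> T (pointwise_stabilizer G A))
       \<longleftrightarrow> (\<forall>a\<in>\<Omega>. coarsely_bounded \<G> T (pointwise_stabilizer G {a})))"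
  (is "(?i \<longleftrightarrow> ?ii) \<and> (?ii \<longleftrightarrow> ?iii) \<and> (?iii \<longleftrightarrow> ?iv) \<and> (?iv \<longleftrightarrow> ?v)")
proof -
  interpret P: permutation_group \<Omega> G
    using assms(6) by (intro permutation_group.intro) (simp add: closed_permutation_group_def)
  have i_ii: ?ii if ?i
    using P.Howe_Moore_open_subgroup[OF universe assms(4)] that unfolding \<G>_def T_def by blast
  have ii_iii: ?iii if ii: ?ii
  proof (intro allI impI, elim conjE)
    fix A assume A: "finite A" "A \<noteq> {}" "A \<subseteq> \<Omega>"
    have "setwise_stabilizer G A \<noteq> G"
      using P.no_invariant_finite_set[OF universe assms(4,5) no_fixed_point assms(8) A]
      by (auto simp: setwise_stabilizer_def)
    then show "coarsely_bounded \<G> T (setwise_stabilizer G A)"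
      using ii P.setwise_stabilizer_subgroup[OF A(3)] P.setwise_stabilizer_open[OF A(1,3)]
      unfolding \<G>_def T_def by blast
  qed
  have iii_iv: ?iv if iii: ?iii
  proof (intro allI impI)
    fix A assume A: "finite A \<and> A \<noteq> {} \<and> A \<subseteq> \<Omega>"
    have "pointwise_stabilizer G A \<subseteq> setwise_stabilizer G A"
      by (auto simp: pointwise_stabilizer_def setwise_stabilizer_def)
    then show "coarsely_bounded \<G> T (pointwise_stabilizer G A)"
      using iii A coarsely_bounded_subset by blast
  qed
  have iv_v: ?v if ?iv using that by auto
  have v_i: ?i if v: ?v
    unfolding Howe_Moore_def
  proof (intro allI impI ballI, elim conjE)
    fix H :: "'h inner_product_space" and \<pi> \<xi> \<eta>
    assume rep: "unitary_representation \<G> T H \<pi>"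
      and no_fixed: "fixed_vectors H \<pi> (carrier \<G>) = {\<zero>\<^bsub>H\<^esub>}"
      and \<xi>: "\<xi> \<in> carrier H" and \<eta>: "\<eta> \<in> carrier H"
    interpret R: permutation_rep \<Omega> G H \<pi>
      using rep P.G.group_axioms P.topspace_perm P.permutation_group_axioms
      unfolding \<G>_def T_def
      by (simp add: permutation_rep_def unitary_rep_def unitary_rep_axioms_def unitary_representation_def)
    have "dissociated_representation \<Omega> G H \<pi>"
      using assms(8) rep unfolding \<G>_def T_def by (simp add: dissociated_group_def)
    then show "(\<lambda>g. iprod H (\<pi> g \<xi>) \<eta>) \<in> C0 \<G> T"
      using R.coefficient_vanishes_at_infinity[OF _ _ _ \<xi> \<eta>] R.coefficient_continuous[OF \<xi> \<eta>]
        no_fixed v unfolding \<G>_def T_def by (simp add: C0_def)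
  qed
  show ?thesis using i_ii ii_iii iii_iv iv_v v_i by blast
qed

end
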